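(* Let $1\leq p<\infty$ and let $\rho\in L^{1}_{loc}(\mathbb{R}^{d})$ be nonnegative and satisfy: (i) $\rho$ is radial and $|\boldsymbol{\xi}|^{-p}\rho(\boldsymbol{\xi})$ is nonincreasing in $|\boldsymbol{\xi}|$; (ii) $\displaystyle\lim_{\delta\to 0}\frac{\delta^{p}}{\int_{B_{\delta}}\rho(\boldsymbol{\xi})\,d\boldsymbol{\xi}}=0$, where $B_\delta$ is the ball of radius $\delta$ centered at the origin. Suppose $\Omega\subset\mathbb{R}^{d}$ is a bounded domain with Lipschitz boundary. Then $\mathcal{S}_{\rho,p}(\Omega)$ is compactly embedded in $L^{p}(\Omega;\mathbb{R}^{d})$: every sequence $\{\mathbf{u}_n\}$ with $\sup_n\big(\|\mathbf{u}_n\|_{L^p(\Omega)}+|\mathbf{u}_n|_{\mathcal{S}_{\rho,p}(\Omega)}\big)<\infty$ is precompact in $L^{p}(\Omega;\mathbb{R}^{d})$. Moreover, any limit point belongs to $\mathcal{S}_{\rho,p}(\Omega)$.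
   Context: For a domain $\Omega\subset\mathbb{R}^d$, a vector field $\mathbf{u}:\Omega\to\mathbb{R}^d$ and $\mathbf{x}\neq\mathbf{y}$, the projected difference quotient is $\mathscr{D}(\mathbf{u})(\mathbf{x},\mathbf{y})=\frac{\mathbf{u}(\mathbf{y})-\mathbf{u}(\mathbf{x})}{|\mathbf{y}-\mathbf{x}|}\cdot\frac{\mathbf{y}-\mathbf{x}}{|\mathbf{y}-\mathbf{x}|}$. For a nonnegative locally integrable kernel $\rho$ and $1\le p<\infty$, $|\mathbf{u}|^{p}_{\mathcal{S}_{\rho,p}(\Omega)}=\int_\Omega\int_\Omega\rho(\mathbf{y}-\mathbf{x})|\mathscr{D}(\mathbf{u})(\mathbf{x},\mathbf{y})|^{p}\,d\mathbf{y}\,d\mathbf{x}$, and $\mathcal{S}_{\rho,p}(\Omega)=\{\mathbf{u}\in L^p(\Omega;\mathbb{R}^d): |\mathbf{u}|_{\mathcal{S}_{\rho,p}(\Omega)}<\infty\}$ with norm $(\|\mathbf{u}\|_{L^p}^p+|\mathbf{u}|^p_{\mathcal{S}_{\rho,p}})^{1/p}$. *)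

theory Defs
  imports "HOL-Analysis.Analysis"
begin

definition proj_diff_quot :: "('a::euclidean_space \<Rightarrow> 'a) \<Rightarrow> 'a \<Rightarrow> 'a \<Rightarrow> real" where
  "proj_diff_quot u x y = ((u y - u x) \<bullet> (y - x)) / (norm (y - x))\<^sup>2"

definition Lp_pow :: "'a::euclidean_space set \<Rightarrow> real \<Rightarrow> ('a \<Rightarrow> 'a) \<Rightarrow> ennreal" where
  "Lp_pow \<Omega> p u = (\<integral>\<^sup>+ x\<in>\<Omega>. ennreal (norm (u x) powr p) \<partial>lebesgue)"

definition in_Lp :: "'a::euclidean_space set \<Rightarrow> real \<Rightarrow> ('a \<Rightarrow> 'a) \<Rightarrow> bool" where
  "in_Lp \<Omega> p u \<longleftrightarrow> set_borel_measurable lebesgue \<Omega> u \<and> Lp_pow \<Omega> p u < \<infinity>"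

definition S_seminorm_pow ::
  "('a::euclidean_space \<Rightarrow> real) \<Rightarrow> real \<Rightarrow> 'a set \<Rightarrow> ('a \<Rightarrow> 'a) \<Rightarrow> ennreal" where
  "S_seminorm_pow \<rho> p \<Omega> u =
     (\<integral>\<^sup>+ x\<in>\<Omega>. (\<integral>\<^sup>+ y\<in>\<Omega>.
        ennreal (\<rho> (y - x) * \<bar>proj_diff_quot u x y\<bar> powr p) \<partial>lebesgue) \<partial>lebesgue)"

definition in_S_space ::
  "('a::euclidean_space \<Rightarrow> real) \<Rightarrow> real \<Rightarrow> 'a set \<Rightarrow> ('a \<Rightarrow> 'a) \<Rightarrow> bool" where
  "in_S_space \<rho> p \<Omega> u \<longleftrightarrow> in_Lp \<Omega> p u \<and> S_seminorm_pow \<rho> p \<Omega> u < \<infinity>"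

text \<open>Lipschitz boundary: near every boundary point, after choosing a unit direction e,
  Omega coincides with the region strictly above the graph of a Lipschitz function
  defined on the hyperplane orthogonal to e.\<close>
definition lipschitz_boundary :: "'a::euclidean_space set \<Rightarrow> bool" where
  "lipschitz_boundary \<Omega> \<longleftrightarrow>
     (\<forall>x0\<in>frontier \<Omega>. \<exists>r>0. \<exists>e. norm e = 1 \<and> (\<exists>g::'a \<Rightarrow> real. \<exists>L.
        (\<forall>z w. \<bar>g z - g w\<bar> \<le> L * norm (z - w)) \<and>
        \<Omega> \<inter> ball x0 r = {x \<in> ball x0 r. x \<bullet> e > g (x - (x \<bullet> e) *\<^sub>R e)}))"

definition bounded_lipschitz_domain :: "'a::euclidean_space set \<Rightarrow> bool" where
  "bounded_lipschitz_domain \<Omega> \<longleftrightarrow>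
     open \<Omega> \<and> connected \<Omega> \<and> \<Omega> \<noteq> {} \<and> bounded \<Omega> \<and> lipschitz_boundary \<Omega>"

end

(*
Let k(h) = rho(h) / |h|^p. Condition (ii) forces k to be non-integrable near the origin, and by
monotonicity the dyadic weights a_j = 2^(-jd) k(2^(-j) R) already have a divergent sum.
Near a point of the closure of Omega there is a ball B of directions such that x + l g stays in
Omega for x in Omega near that point, g in B and 0 < l <= 1. With a bump psi on B, the matrix
int psi(g) g (x) g dg is positive definite, so that |w(x)| is controlled by the average
  int psi(g) g (g . w(x + eps g)) dg
and by int_B |g . (w(x + eps g) - w(x))| dg; only projected differences enter, and no extension
of w beyond Omega is needed. The p-th powers of the second terms for eps = 2^(-j), weighted by a_j,
sum up to at most a constant times the seminorm of w; since the a_j have a divergent sum, one of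
them is small. The averages are convolutions with Lipschitz kernels, so for a bounded sequence they
converge pointwise along a subsequence, hence in L^p by dominated convergence. Applied to the
differences of the sequence this gives a Cauchy sequence in L^p. Lower semicontinuity of the
seminorm is Fatou's lemma.
*)
theory Submission
  imports Defs "HOL-Complex_Analysis.Great_Picard"
begin

section \<open>Inequalities for powers and \<open>L\<^sup>p\<close> convergence\<close>

text \<open>A projected difference in direction g sees only the component of w along g, so no single
  direction controls |w|. A ball of directions does, because a nonzero vector is not orthogonal to
  almost all of its points. Near the boundary only a one-sided cone of directions stays inside the
  domain, which rules out symmetric mollifiers. The ball is therefore centred away from 0, and it is
  kept in an annulus R/2 < |g| < R so that its dilates by 2^(-j) lie in disjoint annuli and the
  energies of different scales add up without overlap. The scale at which w is close to its average
  depends on w. No mollification error tending to 0 uniformly is available; a pigeonhole argument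
  over finitely many scales takes its place, and this is why condition (ii) enters as the divergence
  of a sum rather than as a lower bound for single weights. Only finitely many scales matter for a
  given accuracy, so kernels whose Lipschitz constants blow up with the scale do no harm.\<close>

lemma powr_sum_le:
  fixes a :: "'b \<Rightarrow> real"
  assumes "finite A" "\<And>i. i \<in> A \<Longrightarrow> 0 \<le> a i" "0 \<le> p"
  shows "(\<Sum>i\<in>A. a i) powr p \<le> real (card A) powr p * (\<Sum>i\<in>A. a i powr p)"
proof (cases "A = {}")
  case False
  \<comment> \<open>Comparison with the largest term gives the factor \<open>card A powr p\<close>,
    cruder than the convexity constant but valid for every \<open>p \<ge> 0\<close>.\<close>
  obtain m where m: "m \<in> A" "\<And>i. i \<in> A \<Longrightarrow> a i \<le> a m"
    using Max_in[of "a ` A"] Max_ge[of "a ` A"] assms(1) False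
    by (metis (no_types, lifting) finite_imageI image_iff image_is_empty)
  have "(\<Sum>i\<in>A. a i) \<le> real (card A) * a m"
    using m sum_bounded_above[of A a "a m"] by simp
  then have "(\<Sum>i\<in>A. a i) powr p \<le> (real (card A) * a m) powr p"
    using assms by (intro powr_mono2 sum_nonneg) auto
  also have "\<dots> = real (card A) powr p * a m powr p"
    using assms m by (simp add: powr_mult)
  also have "\<dots> \<le> real (card A) powr p * (\<Sum>i\<in>A. a i powr p)"
    using assms m by (intro mult_left_mono member_le_sum) auto
  finally show ?thesis .
qed auto

lemma powr_add_le:
  fixes a b :: real
  assumes "0 \<le> a" "0 \<le> b" "0 \<le> p"
  shows "(a + b) powr p \<le> 2 powr p * (a powr p + b powr p)"
  using powr_sum_le[of "UNIV :: bool set" "\<lambda>i. if i then a else b" p] assms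
  by (simp add: UNIV_bool add.commute)

lemma powr_norm_diff_le:
  fixes a b :: "'b::real_normed_vector"
  assumes "0 \<le> p"
  shows "norm (a - b) powr p \<le> 2 powr p * (norm a powr p + norm b powr p)"
proof -
  have "norm (a - b) powr p \<le> (norm a + norm b) powr p"
    using assms by (intro powr_mono2) (auto simp: norm_triangle_ineq4)
  also have "\<dots> \<le> 2 powr p * (norm a powr p + norm b powr p)"
    using assms by (intro powr_add_le) auto
  finally show ?thesis .
qed

lemma powr_abs_diff_le:
  fixes a b :: real
  assumes "0 \<le> p"
  shows "\<bar>a - b\<bar> powr p \<le> 2 powr p * (\<bar>a\<bar> powr p + \<bar>b\<bar> powr p)"
  using powr_norm_diff_le[OF assms, of a b] by simp

lemma le_one_plus_powr:
  fixes t :: real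
  assumes "0 \<le> t" "1 \<le> p"
  shows "t \<le> 1 + t powr p"
proof (cases "t \<le> 1")
  case False
  then have "t powr 1 \<le> t powr p" using assms by (intro powr_mono) auto
  then show ?thesis using False by simp
qed (simp add: add_increasing2)

text \<open>A substitute for Jensen's inequality: for \<open>\<lambda> > 0\<close> one has \<open>t \<le> \<lambda> + \<lambda> powr (1 - p) * t powr p\<close>,
  and \<open>\<lambda>\<close> is taken proportional to the left-hand side.\<close>
lemma powr_integral_le:
  fixes f :: "'b \<Rightarrow> real"
  assumes p: "1 \<le> p" and f: "set_integrable M B f" "\<And>x. x \<in> B \<Longrightarrow> 0 \<le> f x"
    and B: "B \<in> sets M" "emeasure M B < \<infinity>"
  shows "ennreal ((LINT x:B|M. f x) powr p)
    \<le> ennreal ((2 * (1 + measure M B)) powr p) * (\<integral>\<^sup>+x\<in>B. ennreal (f x powr p) \<partial>M)"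
proof -
  define F where "F = (LINT x:B|M. f x)"
  \<comment> \<open>The added 1 keeps \<open>b\<close> positive when \<open>B\<close> is a null set,
    and \<open>b \<ge> 1\<close> gives \<open>l \<le> F / 2\<close> below.\<close>
  define b where "b = 1 + measure M B"
  have b: "b \<ge> 1" "b > 0" by (auto simp: b_def intro: add_pos_nonneg)
  have F0: "F \<ge> 0" unfolding F_def using f(2)
    by (auto simp: set_lebesgue_integral_def indicator_def intro!: integral_nonneg_AE AE_I2)
  show ?thesis
  proof (cases "F = 0")
    case True
    then show ?thesis by (simp add: F_def)
  next
    case False
    with F0 have F: "F > 0" by simp
    \<comment> \<open>With this value \<open>l * measure M B\<close> is at most \<open>F / 2\<close>
      and can be absorbed on the left.\<close>
    define l where "l = F / (2 * b)"
    have l: "l > 0" using F b by (simp add: l_def)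
    have pw: "t \<le> l + l powr (1 - p) * t powr p" if t: "0 \<le> t" for t
    proof (cases "t \<le> l")
      case True
      have "0 \<le> l powr (1 - p) * t powr p" by simp
      with True show ?thesis by linarith
    next
      case False
      with l have t0: "t > 0" by linarith
      have "t = t powr (1 - p) * t powr p" using t0 by (simp add: powr_add[symmetric])
      also have "\<dots> \<le> l powr (1 - p) * t powr p"
        using False l p by (intro mult_right_mono powr_mono2') auto
      finally show ?thesis using l by linarith
    qed
    have [measurable]: "(\<lambda>x. indicator B x * f x) \<in> borel_measurable M"
      using f(1) borel_measurable_integrable by (fastforce simp: set_integrable_def)
    have m1: "(\<lambda>x. ennreal (f x powr p) * indicator B x) \<in> borel_measurable M"
    proof -
      have "(\<lambda>x. ennreal (f x powr p) * indicator B x)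
        = (\<lambda>x. ennreal ((indicator B x * f x) powr p))"
        by (auto simp: indicator_def)
      then show ?thesis by simp
    qed
    have "ennreal F = (\<integral>\<^sup>+x. ennreal (indicator B x *\<^sub>R f x) \<partial>M)"
      unfolding F_def set_lebesgue_integral_def
      using f by (intro nn_integral_eq_integral[symmetric])
        (auto simp: set_integrable_def indicator_def)
    also have "\<dots> \<le> (\<integral>\<^sup>+x. ennreal l * indicator B x
        + ennreal (l powr (1 - p)) * (ennreal (f x powr p) * indicator B x) \<partial>M)"
    proof (intro nn_integral_mono)
      fix x assume "x \<in> space M"
      show "ennreal (indicator B x *\<^sub>R f x) \<le> ennreal l * indicator B x
        + ennreal (l powr (1 - p)) * (ennreal (f x powr p) * indicator B x)"
      proof (cases "x \<in> B")
        case True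
        have "ennreal (f x) \<le> ennreal (l + l powr (1 - p) * f x powr p)"
          using pw[OF f(2)[OF True]] by (rule ennreal_leI)
        also have "\<dots> = ennreal l + ennreal (l powr (1 - p)) * ennreal (f x powr p)"
          using l by (simp add: ennreal_plus ennreal_mult)
        finally show ?thesis using True by simp
      qed simp
    qed
    also have "\<dots> = ennreal l * emeasure M B
        + ennreal (l powr (1 - p)) * (\<integral>\<^sup>+x\<in>B. ennreal (f x powr p) \<partial>M)"
      using m1 B by (simp add: nn_integral_add nn_integral_cmult)
    also have "ennreal l * emeasure M B \<le> ennreal (F / 2)"
    proof -
      have "emeasure M B = ennreal (measure M B)"
        using B by (intro emeasure_eq_ennreal_measure) auto
      then have "ennreal l * emeasure M B = ennreal (l * measure M B)"
        using l by (simp add: ennreal_mult)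
      also have "l * measure M B \<le> l * b" using l by (simp add: b_def)
      also have "l * b = F / 2" using b by (simp add: l_def)
      finally show ?thesis by (simp add: ennreal_leI)
    qed
    finally have main: "ennreal F \<le> ennreal (F/2)
        + ennreal (l powr (1 - p)) * (\<integral>\<^sup>+x\<in>B. ennreal (f x powr p) \<partial>M)"
      by (simp add: add_right_mono)
    show ?thesis
    proof (cases "(\<integral>\<^sup>+x\<in>B. ennreal (f x powr p) \<partial>M)")
      case top
      then show ?thesis using b by (simp add: b_def[symmetric] ennreal_mult_top)
    next
      case (real I)
      have "ennreal F \<le> ennreal (F/2 + l powr (1 - p) * I)"
        using main F real by (simp add: ennreal_mult ennreal_plus)
      then have "F \<le> F/2 + l powr (1 - p) * I"
        using F real by (subst (asm) ennreal_le_iff) auto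
      \<comment> \<open>Multiplying by \<open>l powr (p - 1)\<close> isolates the integral; with
        \<open>l \<le> F / 2\<close> this becomes \<open>l powr p \<le> I\<close>, and
        \<open>F = 2 * b * l\<close> restores the left-hand side.\<close>
      then have "F / 2 * l powr (p - 1) \<le> (l powr (1 - p) * I) * l powr (p - 1)"
        by (intro mult_right_mono) auto
      also have "\<dots> = I" using l by (simp add: powr_add[symmetric] ac_simps)
      finally have 1: "F / 2 * l powr (p - 1) \<le> I" .
      have "l powr p = l * l powr (p - 1)" using l by (simp add: powr_mult_base)
      also have "\<dots> \<le> F / 2 * l powr (p - 1)"
      proof (intro mult_right_mono)
        show "l \<le> F / 2" using F b by (simp add: l_def field_simps)
      qed simp
      finally have "l powr p \<le> I" using 1 by simp
      moreover have "F powr p = (2 * b) powr p * l powr p"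
        using b F by (simp add: l_def powr_mult[symmetric])
      ultimately have "F powr p \<le> (2 * b) powr p * I"
        by (simp add: mult_left_mono)
      then show ?thesis
        using real by (simp add: F_def[symmetric] b_def[symmetric] ennreal_mult[symmetric] ennreal_leI)
    qed
  qed
qed

text \<open>On the finite-measure set \<open>A\<close>, the inequality
  \<open>t \<le> 1 + t powr p\<close> puts L^p inside L^1. The two estimates serve different ends:
  the homogeneous one turns smallness in L^p into smallness in L^1, the additive one bounds the L^1
  norms of an L^p-bounded sequence.\<close>

lemma Lp_imp_integrable:
  fixes g :: "'b \<Rightarrow> 'c::{banach,second_countable_topology}"
  assumes p: "1 \<le> p" and A: "A \<in> sets M" "emeasure M A < \<infinity>"
    and g: "g \<in> borel_measurable M" "\<And>x. x \<notin> A \<Longrightarrow> g x = 0"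
      "(\<integral>\<^sup>+x. ennreal (norm (g x) powr p) \<partial>M) < \<infinity>"
  shows "integrable M g"
    and "ennreal ((\<integral>x. norm (g x) \<partial>M) powr p)
      \<le> ennreal ((2 * (1 + measure M A)) powr p) * (\<integral>\<^sup>+x. ennreal (norm (g x) powr p) \<partial>M)"
    and "(\<integral>x. norm (g x) \<partial>M) \<le> measure M A + enn2real (\<integral>\<^sup>+x. ennreal (norm (g x) powr p) \<partial>M)"
proof -
  note A(1)[measurable] g(1)[measurable]
  have "(\<integral>\<^sup>+x. ennreal (norm (g x)) \<partial>M) \<le> (\<integral>\<^sup>+x. indicator A x + ennreal (norm (g x) powr p) \<partial>M)"
  proof (intro nn_integral_mono)
    fix x
    have "ennreal (norm (g x)) \<le> ennreal (1 + norm (g x) powr p)"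
      using p by (intro ennreal_leI le_one_plus_powr) auto
    then show "ennreal (norm (g x)) \<le> indicator A x + ennreal (norm (g x) powr p)"
      using g(2)[of x] by (cases "x \<in> A") (auto simp: ennreal_plus)
  qed
  also have "\<dots> = emeasure M A + (\<integral>\<^sup>+x. ennreal (norm (g x) powr p) \<partial>M)"
    using A by (simp add: nn_integral_add)
  finally have le: "(\<integral>\<^sup>+x. ennreal (norm (g x)) \<partial>M)
      \<le> emeasure M A + (\<integral>\<^sup>+x. ennreal (norm (g x) powr p) \<partial>M)" .
  also have "\<dots> < \<infinity>" using A g(3) by (simp add: ennreal_add_less_top)
  finally show int: "integrable M g" using g(1) by (intro integrableI_bounded) auto
  have eqs: "(\<lambda>x. indicator A x *\<^sub>R norm (g x)) = (\<lambda>x. norm (g x))"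
    "(\<lambda>x. ennreal (norm (g x) powr p) * indicator A x) = (\<lambda>x. ennreal (norm (g x) powr p))"
    using g(2) by (auto simp: indicator_def fun_eq_iff)
  have "set_integrable M A (\<lambda>x. norm (g x))"
    unfolding set_integrable_def eqs using int by simp
  from powr_integral_le[OF p this _ A] show
    "ennreal ((\<integral>x. norm (g x) \<partial>M) powr p)
      \<le> ennreal ((2 * (1 + measure M A)) powr p) * (\<integral>\<^sup>+x. ennreal (norm (g x) powr p) \<partial>M)"
    unfolding set_lebesgue_integral_def eqs by simp
  obtain I where I: "I \<ge> 0" "(\<integral>\<^sup>+x. ennreal (norm (g x) powr p) \<partial>M) = ennreal I"
    using g(3) by (cases "\<integral>\<^sup>+x. ennreal (norm (g x) powr p) \<partial>M") auto
  have "ennreal (\<integral>x. norm (g x) \<partial>M) = (\<integral>\<^sup>+x. ennreal (norm (g x)) \<partial>M)"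
    using int by (intro nn_integral_eq_integral[symmetric]) auto
  also have "\<dots> \<le> ennreal (measure M A + I)"
    using le A I by (simp add: emeasure_eq_ennreal_measure ennreal_plus)
  finally show "(\<integral>x. norm (g x) \<partial>M) \<le> measure M A + enn2real (\<integral>\<^sup>+x. ennreal (norm (g x) powr p) \<partial>M)"
    using I by (subst (asm) ennreal_le_iff) auto
qed

lemma nn_integral_powr_norm_diff_le:
  fixes f g :: "'b \<Rightarrow> 'c::{banach,second_countable_topology}"
  assumes [measurable]: "f \<in> borel_measurable M" "g \<in> borel_measurable M" and p: "0 \<le> p"
  shows "(\<integral>\<^sup>+x. ennreal (norm (f x - g x) powr p) \<partial>M)
    \<le> ennreal (2 powr p) * ((\<integral>\<^sup>+x. ennreal (norm (f x) powr p) \<partial>M) + (\<integral>\<^sup>+x. ennreal (norm (g x) powr p) \<partial>M))"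
proof -
  have "(\<integral>\<^sup>+x. ennreal (norm (f x - g x) powr p) \<partial>M)
    \<le> (\<integral>\<^sup>+x. ennreal (2 powr p) * (ennreal (norm (f x) powr p) + ennreal (norm (g x) powr p)) \<partial>M)"
    using powr_norm_diff_le[OF p]
    by (intro nn_integral_mono)
      (simp add: ennreal_plus[symmetric] ennreal_mult[symmetric] ennreal_leI del: ennreal_plus)
  then show ?thesis by (simp add: nn_integral_cmult nn_integral_add)
qed

text \<open>The threshold cancels the constant in the homogeneous estimate of
  \<open>Lp_imp_integrable\<close>. Through this lemma the L^1 results on almost everywhere
  convergent subsequences become usable for L^p.\<close>

lemma L1_lt_of_Lp_lt:
  fixes g :: "'b \<Rightarrow> 'c::{banach,second_countable_topology}"
  assumes p: "1 \<le> p" and A: "A \<in> sets M" "emeasure M A < \<infinity>"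
    and g: "g \<in> borel_measurable M" "\<And>x. x \<notin> A \<Longrightarrow> g x = 0" and e: "0 < e"
    and small: "(\<integral>\<^sup>+x. ennreal (norm (g x) powr p) \<partial>M) < ennreal ((e / (2 * (1 + measure M A))) powr p)"
  shows "(\<integral>x. norm (g x) \<partial>M) < e"
proof -
  define k where "k = 2 * (1 + measure M A)"
  have k: "k > 0" by (auto simp: k_def intro: add_pos_nonneg)
  have fin: "(\<integral>\<^sup>+x. ennreal (norm (g x) powr p) \<partial>M) < \<infinity>"
    using small by (rule less_trans) simp
  have "ennreal ((\<integral>x. norm (g x) \<partial>M) powr p)
      \<le> ennreal (k powr p) * (\<integral>\<^sup>+x. ennreal (norm (g x) powr p) \<partial>M)"
    using Lp_imp_integrable(2)[OF p A g fin] by (simp add: k_def)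
  also have "\<dots> < ennreal (k powr p) * ennreal ((e / k) powr p)"
    using small[folded k_def] k by (intro ennreal_mult_strict_left_mono) auto
  also have "\<dots> = ennreal (e powr p)"
    using k e by (simp add: ennreal_mult[symmetric] powr_mult[symmetric])
  finally have "(\<integral>x. norm (g x) \<partial>M) powr p < e powr p"
    by (subst (asm) ennreal_less_iff) auto
  then show ?thesis using e p by (smt (verit) powr_mono2)
qed

lemma Lp_tendsto_imp_AE_subseq:
  fixes f :: "nat \<Rightarrow> 'b \<Rightarrow> 'c::{banach,second_countable_topology}"
  assumes p: "1 \<le> p" and A: "A \<in> sets M" "emeasure M A < \<infinity>"
    and f: "\<And>n. f n \<in> borel_measurable M" "\<And>n x. x \<notin> A \<Longrightarrow> f n x = 0"
    and lim: "(\<lambda>n. \<integral>\<^sup>+x. ennreal (norm (f n x) powr p) \<partial>M) \<longlonglongrightarrow> 0"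
  shows "\<exists>r::nat\<Rightarrow>nat. strict_mono r \<and> (AE x in M. (\<lambda>n. f (r n) x) \<longlonglongrightarrow> 0)"
proof -
  \<comment> \<open>The integrals are known to be finite only from some index on, so the L^1 theorem
    is applied to the sequence shifted by \<open>N\<close>, and the shift is put back at the
    end.\<close>
  have "eventually (\<lambda>n. (\<integral>\<^sup>+x. ennreal (norm (f n x) powr p) \<partial>M) < \<infinity>) sequentially"
    using lim by (rule order_tendstoD) simp
  then obtain N where N: "\<And>n. n \<ge> N \<Longrightarrow> (\<integral>\<^sup>+x. ennreal (norm (f n x) powr p) \<partial>M) < \<infinity>"
    by (auto simp: eventually_sequentially)
  have int: "integrable M (f (n + N))" for n
    by (rule Lp_imp_integrable(1)[OF p A f N]) auto
  have "(\<lambda>n. \<integral>x. norm (f (n + N) x) \<partial>M) \<longlonglongrightarrow> 0"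
  proof (rule order_tendstoI)
    fix a :: real assume "a < 0"
    then have "a < (\<integral>x. norm (f (n + N) x) \<partial>M)" for n
      by (rule less_le_trans) simp
    then show "\<forall>\<^sub>F n in sequentially. a < (\<integral>x. norm (f (n + N) x) \<partial>M)"
      by simp
  next
    fix a :: real assume a: "a > 0"
    have "1 + measure M A > 0" by (auto intro: add_pos_nonneg)
    then have "0 < ennreal ((a / (2 * (1 + measure M A))) powr p)" using a by simp
    then have "\<forall>\<^sub>F n in sequentially. (\<integral>\<^sup>+x. ennreal (norm (f (n + N) x) powr p) \<partial>M)
      < ennreal ((a / (2 * (1 + measure M A))) powr p)"
      using LIMSEQ_ignore_initial_segment[OF lim, of N] by (intro order_tendstoD(2))
    then show "\<forall>\<^sub>F n in sequentially. (\<integral>x. norm (f (n + N) x) \<partial>M) < a"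
      by eventually_elim (rule L1_lt_of_Lp_lt[OF p A f a])
  qed
  from tendsto_L1_AE_subseq[of M "\<lambda>n. f (n + N)", OF int this]
  obtain r where r: "strict_mono (r :: nat \<Rightarrow> nat)" "AE x in M. (\<lambda>n. f (r n + N) x) \<longlonglongrightarrow> 0" by auto
  then show ?thesis by (intro exI[of _ "\<lambda>n. r n + N"]) (auto simp: strict_mono_def)
qed

text \<open>Completeness of L^p by way of L^1: the sequence is also Cauchy in L^1, so a subsequence
  converges almost everywhere, and Fatou's lemma carries the L^p estimate over to its limit.\<close>

lemma Lp_Cauchy_imp_convergent:
  fixes f :: "nat \<Rightarrow> 'b \<Rightarrow> 'c::{banach,second_countable_topology}"
  assumes p: "1 \<le> p" and A: "A \<in> sets M" "emeasure M A < \<infinity>"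
    and f: "\<And>n. f n \<in> borel_measurable M" "\<And>n x. x \<notin> A \<Longrightarrow> f n x = 0"
      "\<And>n. (\<integral>\<^sup>+x. ennreal (norm (f n x) powr p) \<partial>M) < \<infinity>"
    and cau: "\<And>e::ennreal. 0 < e \<Longrightarrow> \<exists>N. \<forall>n\<ge>N. \<forall>m\<ge>N. (\<integral>\<^sup>+x. ennreal (norm (f n x - f m x) powr p) \<partial>M) < e"
  obtains v where "v \<in> borel_measurable M" "\<And>x. x \<notin> A \<Longrightarrow> v x = 0"
    "(\<integral>\<^sup>+x. ennreal (norm (v x) powr p) \<partial>M) < \<infinity>"
    "(\<lambda>n. \<integral>\<^sup>+x. ennreal (norm (f n x - v x) powr p) \<partial>M) \<longlonglongrightarrow> 0"
proof -
  note f(1)[measurable]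
  have int: "integrable M (f n)" for n
    by (rule Lp_imp_integrable(1)[OF p A f])
  have "\<exists>N. \<forall>i\<ge>N. \<forall>j\<ge>N. LINT x|M. norm (f i x - f j x) < e" if e: "e > 0" for e
  proof -
    have "1 + measure M A > 0" by (auto intro: add_pos_nonneg)
    then have "0 < ennreal ((e / (2 * (1 + measure M A))) powr p)" using e by simp
    from cau[OF this] obtain N where N: "\<forall>n\<ge>N. \<forall>m\<ge>N. (\<integral>\<^sup>+x. ennreal (norm (f n x - f m x) powr p) \<partial>M)
      < ennreal ((e / (2 * (1 + measure M A))) powr p)" by blast
    show ?thesis
    proof (intro exI[of _ N] allI impI)
      fix i j assume "i \<ge> N" "j \<ge> N"
      with N have "(\<integral>\<^sup>+x. ennreal (norm (f i x - f j x) powr p) \<partial>M)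
        < ennreal ((e / (2 * (1 + measure M A))) powr p)" by blast
      then show "LINT x|M. norm (f i x - f j x) < e"
        using f(2) by (intro L1_lt_of_Lp_lt[OF p A _ _ e]) auto
    qed
  qed
  from cauchy_L1_AE_cauchy_subseq[OF int this]
  obtain r where r: "strict_mono (r :: nat \<Rightarrow> nat)" "AE x in M. Cauchy (\<lambda>i. f (r i) x)" by blast
  \<comment> \<open>Where the subsequence does not converge, \<open>lim\<close> returns an
    unspecified value; this happens only on a null set, and never outside \<open>A\<close>.\<close>
  define v where "v x = lim (\<lambda>i. f (r i) x)" for x
  have [measurable]: "v \<in> borel_measurable M" unfolding v_def by measurable
  have v0: "v x = 0" if "x \<notin> A" for x
    using f(2)[OF that] by (simp add: v_def)
  have ae: "AE x in M. (\<lambda>i. f (r i) x) \<longlonglongrightarrow> v x"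
    using r(2) by eventually_elim (simp add: v_def Cauchy_convergent_iff convergent_LIMSEQ_iff)
  have bd: "(\<integral>\<^sup>+x. ennreal (norm (f n x - v x) powr p) \<partial>M) \<le> e"
    if N: "\<And>n m. n \<ge> N \<Longrightarrow> m \<ge> N \<Longrightarrow> (\<integral>\<^sup>+x. ennreal (norm (f n x - f m x) powr p) \<partial>M) < e" and n: "n \<ge> N" for e N n
  proof -
    have "(\<integral>\<^sup>+x. ennreal (norm (f n x - v x) powr p) \<partial>M)
        = (\<integral>\<^sup>+x. liminf (\<lambda>i. ennreal (norm (f n x - f (r i) x) powr p)) \<partial>M)"
    proof (rule nn_integral_cong_AE)
      show "AE x in M. ennreal (norm (f n x - v x) powr p) = liminf (\<lambda>i. ennreal (norm (f n x - f (r i) x) powr p))"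
        using ae
      proof eventually_elim
        case (elim x)
        have "(\<lambda>i. norm (f n x - f (r i) x) powr p) \<longlonglongrightarrow> norm (f n x - v x) powr p"
          using p elim by (intro tendsto_powr' tendsto_intros) auto
        then have "(\<lambda>i. ennreal (norm (f n x - f (r i) x) powr p)) \<longlonglongrightarrow> ennreal (norm (f n x - v x) powr p)"
          by (rule tendsto_ennrealI)
        then show ?case by (rule lim_imp_Liminf[symmetric, rotated]) simp
      qed
    qed
    also have "\<dots> \<le> liminf (\<lambda>i. \<integral>\<^sup>+x. ennreal (norm (f n x - f (r i) x) powr p) \<partial>M)"
      by (rule nn_integral_liminf) simp
    also have "\<dots> \<le> limsup (\<lambda>i. \<integral>\<^sup>+x. ennreal (norm (f n x - f (r i) x) powr p) \<partial>M)"
      by (rule Liminf_le_Limsup) simp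
    also have "\<dots> \<le> e"
    proof (rule Limsup_bounded)
      show "\<forall>\<^sub>F i in sequentially. (\<integral>\<^sup>+x. ennreal (norm (f n x - f (r i) x) powr p) \<partial>M) \<le> e"
        unfolding eventually_sequentially
        using N n seq_suble[OF r(1)] by (intro exI[of _ N]) (meson less_imp_le order_trans)
    qed
    finally show ?thesis .
  qed
  have lim: "(\<lambda>n. \<integral>\<^sup>+x. ennreal (norm (f n x - v x) powr p) \<partial>M) \<longlonglongrightarrow> 0"
  proof (rule order_tendstoI)
    fix a :: ennreal assume "0 < a"
    \<comment> \<open>Fatou's lemma preserves only \<open>\<le>\<close>, hence a level strictly
      between 0 and \<open>a\<close>.\<close>
    then obtain e where e: "0 < e" "e < a" using dense by blast
    obtain N where "\<forall>n\<ge>N. \<forall>m\<ge>N. (\<integral>\<^sup>+x. ennreal (norm (f n x - f m x) powr p) \<partial>M) < e"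
      using cau[OF e(1)] by blast
    then show "\<forall>\<^sub>F n in sequentially. (\<integral>\<^sup>+x. ennreal (norm (f n x - v x) powr p) \<partial>M) < a"
      unfolding eventually_sequentially
      by (intro exI[of _ N] allI impI le_less_trans[OF bd[of N e] e(2)]) auto
  qed simp
  obtain N where "\<forall>n\<ge>N. \<forall>m\<ge>N. (\<integral>\<^sup>+x. ennreal (norm (f n x - f m x) powr p) \<partial>M) < 1"
    using cau[of 1] by auto
  then have "(\<integral>\<^sup>+x. ennreal (norm (f N x - v x) powr p) \<partial>M) \<le> 1" by (intro bd[of N]) auto
  then have fin: "(\<integral>\<^sup>+x. ennreal (norm (f N x - v x) powr p) \<partial>M) < \<infinity>"
    by (rule le_less_trans) simp
  have "(\<integral>\<^sup>+x. ennreal (norm (v x) powr p) \<partial>M)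
    \<le> ennreal (2 powr p) * ((\<integral>\<^sup>+x. ennreal (norm (f N x) powr p) \<partial>M) + (\<integral>\<^sup>+x. ennreal (norm (f N x - v x) powr p) \<partial>M))"
    using nn_integral_powr_norm_diff_le[of "f N" M "\<lambda>x. f N x - v x" p] p by simp
  also have "\<dots> < \<infinity>"
    using f(3)[of N] fin by (simp add: ennreal_mult_less_top)
  finally show ?thesis using that[of v] v0 lim by simp
qed

section \<open>Averages with Lipschitz kernels\<close>

lemma bounded_kernel_integrable:
  fixes \<Phi> u :: "'a::euclidean_space \<Rightarrow> 'a"
  assumes u: "integrable lborel u" and \<Phi>: "\<Phi> \<in> borel_measurable borel" "\<And>g. norm (\<Phi> g) \<le> K"
  shows "integrable lborel (\<lambda>y. \<Phi> (y - x) \<bullet> u y)"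
proof (rule Bochner_Integration.integrable_bound)
  show "integrable lborel (\<lambda>y. K * norm (u y))" using u by simp
  note \<Phi>(1)[measurable]
  have [measurable]: "u \<in> borel_measurable borel" using u by (simp add: borel_measurable_integrable)
  show "(\<lambda>y. \<Phi> (y - x) \<bullet> u y) \<in> borel_measurable lborel" by simp
  have "\<bar>\<Phi> (y - x) \<bullet> u y\<bar> \<le> \<bar>K * norm (u y)\<bar>" for y
    using Cauchy_Schwarz_ineq2[of "\<Phi> (y-x)" "u y"] mult_right_mono[OF \<Phi>(2)[of "y-x"], of "norm (u y)"]
    by simp
  then show "AE y in lborel. norm (\<Phi> (y - x) \<bullet> u y) \<le> norm (K * norm (u y))" by simp
qed

lemma bounded_kernel_integral_le:
  fixes \<Phi> u :: "'a::euclidean_space \<Rightarrow> 'a"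
  assumes u: "integrable lborel u" and \<Phi>: "\<Phi> \<in> borel_measurable borel" "\<And>g. norm (\<Phi> g) \<le> K"
  shows "\<bar>\<integral>y. \<Phi> (y - x) \<bullet> u y \<partial>lborel\<bar> \<le> K * (\<integral>y. norm (u y) \<partial>lborel)"
proof -
  have "\<bar>\<integral>y. \<Phi> (y - x) \<bullet> u y \<partial>lborel\<bar> \<le> (\<integral>y. \<bar>\<Phi> (y - x) \<bullet> u y\<bar> \<partial>lborel)"
    by (rule integral_abs_bound)
  also have "\<dots> \<le> (\<integral>y. K * norm (u y) \<partial>lborel)"
  proof (rule integral_mono)
    show "\<bar>\<Phi> (y - x) \<bullet> u y\<bar> \<le> K * norm (u y)" for y
      using Cauchy_Schwarz_ineq2[of "\<Phi> (y-x)" "u y"] mult_right_mono[OF \<Phi>(2)[of "y-x"], of "norm (u y)"]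
      by simp
  qed (use u bounded_kernel_integrable[OF u \<Phi>] in auto)
  finally show ?thesis by simp
qed

text \<open>The Arzela-Ascoli argument: for each kernel the averages are bounded and Lipschitz in
  \<open>x\<close> with constants independent of \<open>n\<close>. A diagonal subsequence converges
  for all \<open>i\<close> at the points of a countable dense set, and equicontinuity extends this
  to all \<open>x\<close>.\<close>

lemma Lipschitz_kernels_convergent_subsequence:
  fixes \<Phi> :: "'i \<Rightarrow> 'a::euclidean_space \<Rightarrow> 'a" and u :: "nat \<Rightarrow> 'a \<Rightarrow> 'a"
  assumes I: "countable I"
    and bdd: "\<And>i g. i \<in> I \<Longrightarrow> norm (\<Phi> i g) \<le> K i"
    and lip: "\<And>i g h. i \<in> I \<Longrightarrow> norm (\<Phi> i g - \<Phi> i h) \<le> K i * norm (g - h)"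
    and u: "\<And>n. integrable lborel (u n)" "\<And>n. (\<integral>y. norm (u n y) \<partial>lborel) \<le> C"
  shows "\<exists>r::nat\<Rightarrow>nat. strict_mono r \<and>
    (\<forall>i\<in>I. \<forall>x. convergent (\<lambda>n. \<integral>y. \<Phi> i (y - x) \<bullet> u (r n) y \<partial>lborel))"
proof -
  have "0 \<le> (\<integral>y. norm (u 0 y) \<partial>lborel)" by simp
  then have C0: "0 \<le> C" using u(2)[of 0] by linarith
  \<comment> \<open>\<open>K i\<close> may vanish; \<open>K' i\<close> is positive and can be
    divided by.\<close>
  define K' where "K' i = \<bar>K i\<bar> + 1" for i
  have K': "0 < K' i" "K i \<le> K' i" for i by (auto simp: K'_def)
  have meas: "\<Phi> i \<in> borel_measurable borel" if "i \<in> I" for i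
  proof (intro borel_measurable_continuous_onI lipschitz_on_continuous_on)
    show "(K' i)-lipschitz_on UNIV (\<Phi> i)"
    proof (rule lipschitz_onI)
      fix g h
      show "dist (\<Phi> i g) (\<Phi> i h) \<le> K' i * dist g h"
        using lip[OF that, of g h] mult_right_mono[OF K'(2)[of i], of "norm (g - h)"]
        by (simp add: dist_norm)
    qed (use K' less_imp_le in blast)
  qed
  define F where "F i x n = (\<integral>y. \<Phi> i (y - x) \<bullet> u n y \<partial>lborel)" for i x n
  have Fb: "\<bar>F i x n\<bar> \<le> K' i * C" if "i \<in> I" for i x n
  proof -
    have "\<bar>F i x n\<bar> \<le> K' i * (\<integral>y. norm (u n y) \<partial>lborel)"
      unfolding F_def
      by (rule bounded_kernel_integral_le[OF u(1) meas[OF that]])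
        (rule order_trans[OF bdd[OF that] K'(2)])
    also have "\<dots> \<le> K' i * C" using u(2) K'(1)[of i] by (intro mult_left_mono) auto
    finally show ?thesis .
  qed
  have FL: "\<bar>F i x n - F i x' n\<bar> \<le> K' i * C * norm (x - x')" if i: "i \<in> I" for i x x' n
  proof -
    have int: "integrable lborel (\<lambda>y. \<Phi> i (y - x) \<bullet> u n y)" for x
      by (rule bounded_kernel_integrable[OF u(1) meas[OF i] bdd[OF i]])
    have "F i x n - F i x' n = (\<integral>y. \<Phi> i (y - x) \<bullet> u n y - \<Phi> i (y - x') \<bullet> u n y \<partial>lborel)"
      unfolding F_def using int by simp
    also have "\<bar>\<dots>\<bar> \<le> (\<integral>y. \<bar>\<Phi> i (y - x) \<bullet> u n y - \<Phi> i (y - x') \<bullet> u n y\<bar> \<partial>lborel)"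
      by (rule integral_abs_bound)
    also have "\<dots> \<le> (\<integral>y. K' i * norm (x - x') * norm (u n y) \<partial>lborel)"
    proof (rule integral_mono)
      fix y
      have "\<bar>\<Phi> i (y - x) \<bullet> u n y - \<Phi> i (y - x') \<bullet> u n y\<bar>
          \<le> norm (\<Phi> i (y - x) - \<Phi> i (y - x')) * norm (u n y)"
        using Cauchy_Schwarz_ineq2 by (simp add: inner_diff_left[symmetric])
      also have "norm (\<Phi> i (y - x) - \<Phi> i (y - x')) \<le> K' i * norm (x - x')"
        using lip[OF i, of "y - x" "y - x'"] mult_right_mono[OF K'(2)[of i], of "norm (x - x')"]
        by (simp add: norm_minus_commute)
      finally show "\<bar>\<Phi> i (y - x) \<bullet> u n y - \<Phi> i (y - x') \<bullet> u n y\<bar> \<le> K' i * norm (x - x') * norm (u n y)"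
        by (simp add: mult_right_mono)
    qed (use int u in auto)
    also have "\<dots> = K' i * norm (x - x') * (\<integral>y. norm (u n y) \<partial>lborel)" by simp
    also have "\<dots> \<le> K' i * norm (x - x') * C"
      using u(2) K'(1)[of i] by (intro mult_left_mono) auto
    finally show ?thesis by (simp add: mult_ac)
  qed
  obtain D :: "'a set" where D: "countable D" "\<And>X. open X \<Longrightarrow> X \<noteq> {} \<Longrightarrow> \<exists>d\<in>D. d \<in> X"
    by (rule countable_dense_setE) blast
  \<comment> \<open>The diagonal theorem asks for one bound common to all pairs of a kernel and a
    point, hence the division by \<open>K' i\<close>.\<close>
  have FK: "norm (F (fst q) (snd q) n / K' (fst q)) \<le> C" if "q \<in> I \<times> D" for n q
    using Fb[of "fst q" "snd q" n] that K'(1)[of "fst q"] by (auto simp: field_simps)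
  obtain r where r: "strict_mono (r :: nat \<Rightarrow> nat)"
      "\<And>q. q \<in> I \<times> D \<Longrightarrow> \<exists>l. (\<lambda>n. F (fst q) (snd q) (r n) / K' (fst q)) \<longlonglongrightarrow> l"
    by (rule function_convergent_subsequence[of "I \<times> D" "\<lambda>n q. F (fst q) (snd q) n / K' (fst q)" C])
      (use I D(1) FK in auto)
  show ?thesis
  proof (intro exI[of _ r] conjI ballI allI r(1))
    fix i x assume i: "i \<in> I"
    have "Cauchy (\<lambda>n. F i x (r n))"
    proof (rule metric_CauchyI)
      fix e :: real assume e: "e > 0"
      \<comment> \<open>Moving from \<open>x\<close> to a dense point within \<open>d\<close>
        changes the average by at most e/4; two such errors and the e/2 at the dense point stay
        below \<open>e\<close>. The 1 in the denominator covers \<open>C = 0\<close>.\<close>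
      define d where "d = e / (4 * (K' i * C + 1))"
      have pos: "K' i * C + 1 > 0" using K'(1)[of i] C0 by (simp add: add_nonneg_pos)
      have d: "d > 0" using e pos by (simp add: d_def)
      obtain q where q: "q \<in> D" "q \<in> ball x d" using D(2)[of "ball x d"] d by auto
      obtain l where "(\<lambda>n. F i q (r n) / K' i) \<longlonglongrightarrow> l" using r(2)[of "(i, q)"] i q by auto
      then have "(\<lambda>n. F i q (r n) / K' i * K' i) \<longlonglongrightarrow> l * K' i" by (intro tendsto_mult) auto
      then have "(\<lambda>n. F i q (r n)) \<longlonglongrightarrow> l * K' i" using K'(1)[of i] by simp
      then have "Cauchy (\<lambda>n. F i q (r n))" by (rule LIMSEQ_imp_Cauchy)
      then obtain N where N: "\<And>m n. m \<ge> N \<Longrightarrow> n \<ge> N \<Longrightarrow> dist (F i q (r m)) (F i q (r n)) < e/2"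
        using e by (metis metric_CauchyD half_gt_zero)
      have close: "\<bar>F i x n - F i q n\<bar> \<le> e/4" for n
      proof -
        have "\<bar>F i x n - F i q n\<bar> \<le> K' i * C * norm (x - q)" by (rule FL[OF i])
        also have "\<dots> \<le> (K' i * C + 1) * d"
          using q K'(1)[of i] C0 by (intro mult_mono) (auto simp: dist_norm)
        also have "b * (e / (4 * b)) = e/4" if "b > 0" for b using that by simp
        then have "(K' i * C + 1) * d = e/4" unfolding d_def using pos by blast
        finally show ?thesis .
      qed
      show "\<exists>M. \<forall>m\<ge>M. \<forall>n\<ge>M. dist (F i x (r m)) (F i x (r n)) < e"
      proof (intro exI[of _ N] allI impI)
        fix m n assume "m \<ge> N" "n \<ge> N"
        then show "dist (F i x (r m)) (F i x (r n)) < e"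
          using N[of m n] close[of "r m"] close[of "r n"] unfolding dist_real_def by linarith
      qed
    qed
    then show "convergent (\<lambda>n. \<integral>y. \<Phi> i (y - x) \<bullet> u (r n) y \<partial>lborel)"
      unfolding F_def by (rule Cauchy_convergent)
  qed
qed

text \<open>Dominated convergence towards the pointwise limit, through which two members are then
  compared. The conclusion has Cauchy form because it will be applied to differences of two members
  of a sequence.\<close>

lemma bounded_convergent_imp_Cauchy_powr:
  fixes f :: "nat \<Rightarrow> 'b \<Rightarrow> real"
  assumes p: "0 < p" and A: "A \<in> sets M" "emeasure M A < \<infinity>"
    and f: "\<And>n. f n \<in> borel_measurable M" "\<And>x. x \<in> A \<Longrightarrow> convergent (\<lambda>n. f n x)"
      "\<And>n x. x \<in> A \<Longrightarrow> \<bar>f n x\<bar> \<le> K"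
    and e: "0 < (e::ennreal)"
  shows "\<exists>N. \<forall>n\<ge>N. \<forall>m\<ge>N. (\<integral>\<^sup>+x\<in>A. ennreal (\<bar>f n x - f m x\<bar> powr p) \<partial>M) < e"
proof -
  \<comment> \<open>The indicator makes the sequence converge everywhere, with limit 0 outside
    \<open>A\<close>.\<close>
  define l where "l x = lim (\<lambda>n. f n x * indicator A x)" for x
  note f(1)[measurable] A(1)[measurable]
  have [measurable]: "l \<in> borel_measurable M" unfolding l_def by measurable
  have lim: "(\<lambda>n. f n x) \<longlonglongrightarrow> l x" if "x \<in> A" for x
    using f(2)[OF that] that by (simp add: l_def convergent_LIMSEQ_iff)
  have lb: "\<bar>l x\<bar> \<le> K" if "x \<in> A" for x
    using tendsto_upperbound[OF tendsto_rabs[OF lim[OF that]], of K] f(3)[OF that] by auto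
  define G where "G n = (\<integral>\<^sup>+x\<in>A. ennreal (\<bar>f n x - l x\<bar> powr p) \<partial>M)" for n
  have "G \<longlonglongrightarrow> (\<integral>\<^sup>+x. 0 \<partial>M)"
    unfolding G_def
  proof (rule nn_integral_dominated_convergence)
    show "AE x in M. ennreal (\<bar>f n x - l x\<bar> powr p) * indicator A x \<le> ennreal ((2 * K) powr p) * indicator A x" for n
    proof (intro AE_I2)
      fix x
      have "\<bar>f n x - l x\<bar> powr p \<le> (2 * K) powr p" if "x \<in> A"
        using f(3)[OF that, of n] lb[OF that] p by (intro powr_mono2) auto
      then show "ennreal (\<bar>f n x - l x\<bar> powr p) * indicator A x \<le> ennreal ((2 * K) powr p) * indicator A x"
        by (auto simp: indicator_def intro!: ennreal_leI)
    qed
    show "(\<integral>\<^sup>+x. ennreal ((2 * K) powr p) * indicator A x \<partial>M) < \<infinity>"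
      using A by (simp add: nn_integral_cmult_indicator ennreal_mult_less_top)
    show "AE x in M. (\<lambda>n. ennreal (\<bar>f n x - l x\<bar> powr p) * indicator A x) \<longlonglongrightarrow> 0"
    proof (intro AE_I2)
      fix x
      show "(\<lambda>n. ennreal (\<bar>f n x - l x\<bar> powr p) * indicator A x) \<longlonglongrightarrow> 0"
      proof (cases "x \<in> A")
        case True
        have "(\<lambda>n. \<bar>f n x - l x\<bar> powr p) \<longlonglongrightarrow> \<bar>l x - l x\<bar> powr p"
          using p by (intro tendsto_powr' tendsto_intros lim True) auto
        then have "(\<lambda>n. ennreal (\<bar>f n x - l x\<bar> powr p)) \<longlonglongrightarrow> ennreal 0"
          by (intro tendsto_ennrealI) simp
        then show ?thesis using True by simp
      qed simp
    qed
  qed measurable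
  then have G: "G \<longlonglongrightarrow> 0" by simp
  define c where "c = ennreal (2 powr p)"
  have "(\<lambda>n. c * G n) \<longlonglongrightarrow> c * 0"
    using G by (intro ennreal_tendsto_cmult) (auto simp: c_def)
  then have lim0: "(\<lambda>n. c * G n) \<longlonglongrightarrow> 0" by simp
  obtain e' :: ennreal where e': "e' > 0" "e' + e' \<le> e"
  proof (cases e)
    case top
    then show ?thesis using that[of 1] by simp
  next
    case (real x)
    then show ?thesis using e that[of "ennreal (x/2)"] by (simp add: ennreal_plus[symmetric] del: ennreal_plus)
  qed
  have "eventually (\<lambda>n. c * G n < e') sequentially"
    using lim0 e'(1) by (rule order_tendstoD)
  then obtain N where N: "\<And>n. n \<ge> N \<Longrightarrow> c * G n < e'" by (auto simp: eventually_sequentially)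
  have "(\<integral>\<^sup>+x\<in>A. ennreal (\<bar>f n x - f m x\<bar> powr p) \<partial>M) \<le> c * G n + c * G m" for n m
  proof -
    have "(\<integral>\<^sup>+x\<in>A. ennreal (\<bar>f n x - f m x\<bar> powr p) \<partial>M)
      \<le> (\<integral>\<^sup>+x. c * (ennreal (\<bar>f n x - l x\<bar> powr p) * indicator A x)
            + c * (ennreal (\<bar>f m x - l x\<bar> powr p) * indicator A x) \<partial>M)"
    proof (intro nn_integral_mono)
      fix x
      have "\<bar>f n x - f m x\<bar> powr p \<le> 2 powr p * (\<bar>f n x - l x\<bar> powr p + \<bar>f m x - l x\<bar> powr p)"
        using powr_abs_diff_le[of p "f n x - l x" "f m x - l x"] p by simp
      then have "ennreal (\<bar>f n x - f m x\<bar> powr p)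
          \<le> ennreal (2 powr p * (\<bar>f n x - l x\<bar> powr p + \<bar>f m x - l x\<bar> powr p))"
        by (rule ennreal_leI)
      also have "\<dots> = c * ennreal (\<bar>f n x - l x\<bar> powr p) + c * ennreal (\<bar>f m x - l x\<bar> powr p)"
        by (simp add: c_def ennreal_mult[symmetric] ennreal_plus[symmetric] distrib_left del: ennreal_plus)
      finally show "ennreal (\<bar>f n x - f m x\<bar> powr p) * indicator A x
        \<le> c * (ennreal (\<bar>f n x - l x\<bar> powr p) * indicator A x)
            + c * (ennreal (\<bar>f m x - l x\<bar> powr p) * indicator A x)"
        by (auto simp: indicator_def)
    qed
    also have "\<dots> = c * G n + c * G m"
      unfolding G_def by (subst nn_integral_add) (auto simp: nn_integral_cmult)
    finally show ?thesis .
  qed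
  moreover have "c * G n + c * G m < e" if "n \<ge> N" "m \<ge> N" for n m
    using add_strict_mono[OF N[OF that(1)] N[OF that(2)]] e'(2) by (rule less_le_trans)
  ultimately show ?thesis by (intro exI[of _ N] allI impI) (rule le_less_trans)
qed

section \<open>Affine substitution, the bump function and its kernels\<close>

lemma nn_integral_lborel_affine:
  fixes f :: "'a::euclidean_space \<Rightarrow> ennreal"
  assumes [measurable]: "f \<in> borel_measurable borel" and c: "0 < c"
  shows "(\<integral>\<^sup>+y. f y \<partial>lborel) = ennreal (c ^ DIM('a)) * (\<integral>\<^sup>+g. f (t + c *\<^sub>R g) \<partial>lborel)"
  using c by (subst lborel_affine[of c t])
    (simp_all add: nn_integral_density nn_integral_distr nn_integral_cmult)

lemma integral_lborel_affine:
  fixes f :: "'a::euclidean_space \<Rightarrow> real"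
  assumes [measurable]: "f \<in> borel_measurable borel" and c: "0 < c"
  shows "(\<integral>y. f y \<partial>lborel) = c ^ DIM('a) * (\<integral>g. f (t + c *\<^sub>R g) \<partial>lborel)"
  using c by (subst lborel_affine[of c t]) (simp_all add: integral_density integral_distr)

lemma integrable_lborel_affine:
  fixes f :: "'a::euclidean_space \<Rightarrow> 'b::{banach,second_countable_topology}"
  assumes f: "integrable lborel f" and c: "0 < c"
  shows "integrable lborel (\<lambda>g. f (t + c *\<^sub>R g))"
proof (rule integrableI_bounded)
  have [measurable]: "f \<in> borel_measurable borel" using borel_measurable_integrable[OF f] by simp
  show "(\<lambda>g. f (t + c *\<^sub>R g)) \<in> borel_measurable lborel" by simp
  have "ennreal (c ^ DIM('a)) * (\<integral>\<^sup>+g. ennreal (norm (f (t + c *\<^sub>R g))) \<partial>lborel) < \<infinity>"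
    using f nn_integral_lborel_affine[of "\<lambda>y. ennreal (norm (f y))" c t] c
    by (simp add: integrable_iff_bounded)
  then show "(\<integral>\<^sup>+g. ennreal (norm (f (t + c *\<^sub>R g))) \<partial>lborel) < \<infinity>"
    using c by (auto simp: ennreal_mult_less_top)
qed

text \<open>A tent function supported in the closed ball. Lipschitz continuity is all the regularity
  that the averages need; it is not normalised, its size being accounted for in the lower bound for
  the quadratic form.\<close>

definition bump :: "'a::real_normed_vector \<Rightarrow> real \<Rightarrow> 'a \<Rightarrow> real" where
  "bump z s g = max 0 (s - norm (g - z))"

lemma bump_nonneg [simp]: "0 \<le> bump z s g"
  by (simp add: bump_def)

lemma bump_le: "0 \<le> s \<Longrightarrow> bump z s g \<le> s"
  by (simp add: bump_def)

lemma bump_eq_0: "g \<notin> ball z s \<Longrightarrow> bump z s g = 0"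
  by (auto simp: bump_def dist_norm norm_minus_commute)

lemma bump_diff_le: "\<bar>bump z s g - bump z s h\<bar> \<le> norm (g - h)"
proof -
  have "\<bar>norm (g - z) - norm (h - z)\<bar> \<le> norm (g - h)"
    using norm_triangle_ineq3[of "g - z" "h - z"] by simp
  then show ?thesis unfolding bump_def by linarith
qed

lemma continuous_on_bump: "continuous_on A (bump z s)"
  unfolding bump_def by (intro continuous_intros)

lemma borel_measurable_bump [measurable]:
  "bump z s \<in> borel_measurable (borel :: 'a::euclidean_space measure)"
  by (intro borel_measurable_continuous_onI continuous_on_bump)

text \<open>The bump averages \<open>g \<otimes> g\<close> to a positive definite matrix: with the
  sign \<open>\<sigma>\<close> of \<open>z \<bullet> v\<close>, every \<open>g\<close> within \<open>s/4\<close> of \<open>z + \<sigma> (s/2) v / norm v\<close> has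
  \<open>\<bar>g \<bullet> v\<bar> \<ge> s/4 * norm v\<close>.\<close>
lemma bump_quadratic_form_lower_bound:
  fixes z v :: "'a::euclidean_space"
  assumes s: "0 < s"
  shows "(s/4)^3 * measure lborel (ball (0::'a) (s/4)) * (norm v)\<^sup>2
    \<le> (\<integral>g. bump z s g * (g \<bullet> v)\<^sup>2 \<partial>lborel)"
proof (cases "v = 0")
  case False
  define \<sigma> :: real where "\<sigma> = (if z \<bullet> v \<ge> 0 then 1 else -1)"
  define c where "c = z + (\<sigma> * (s/2) / norm v) *\<^sub>R v"
  have sg: "\<sigma> * \<sigma> = 1" "\<sigma> * (z \<bullet> v) \<ge> 0" "\<bar>\<sigma>\<bar> = 1" by (auto simp: \<sigma>_def)
  \<comment> \<open>One factor \<open>s/4\<close> bounds the bump from below, the other two come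
    from the square of \<open>g \<bullet> v\<close>.\<close>
  have pt: "indicator (ball c (s/4)) g * ((s/4)^3 * (norm v)\<^sup>2) \<le> max 0 (s - norm (g - z)) * (g \<bullet> v)\<^sup>2" for g
  proof (cases "g \<in> ball c (s/4)")
    case True
    define k where "k = g - c"
    have k: "norm k < s/4" using True by (simp add: k_def dist_norm norm_minus_commute)
    have gz: "g - z = k + (\<sigma> * (s/2) / norm v) *\<^sub>R v" by (simp add: k_def c_def)
    have "norm (g - z) \<le> norm k + s/2"
      unfolding gz using False s sg(3) by (intro norm_triangle_le) (simp add: abs_mult)
    then have 1: "s/4 \<le> max 0 (s - norm (g - z))" using k by linarith
    have vv: "v \<bullet> v = norm v * norm v" by (simp add: power2_norm_eq_inner[symmetric] power2_eq_square)
    have "g = z + k + (\<sigma> * (s/2) / norm v) *\<^sub>R v" using gz by (simp add: algebra_simps)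
    \<comment> \<open>Of the three terms the first is nonnegative by the choice of
      \<open>\<sigma>\<close>, the second is at least \<open>- (s/4 * norm v)\<close>, and the third
      equals \<open>s/2 * norm v\<close>.\<close>
    then have "\<sigma> * (g \<bullet> v) = \<sigma> * (z \<bullet> v) + \<sigma> * (k \<bullet> v) + (\<sigma> * \<sigma>) * (s/2) * norm v"
      using False by (simp add: inner_add_left vv field_simps)
    moreover have "\<bar>\<sigma> * (k \<bullet> v)\<bar> \<le> s/4 * norm v"
    proof -
      have "\<bar>\<sigma> * (k \<bullet> v)\<bar> \<le> norm k * norm v"
        using Cauchy_Schwarz_ineq2[of k v] sg(3) by (simp add: abs_mult)
      also have "\<dots> \<le> s/4 * norm v" using k by (intro mult_right_mono) auto
      finally show ?thesis .
    qed
    ultimately have "s/4 * norm v \<le> \<sigma> * (g \<bullet> v)" using sg by simp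
    then have "(s/4 * norm v)\<^sup>2 \<le> (\<sigma> * (g \<bullet> v))\<^sup>2" using s by (intro power_mono) auto
    also have "\<dots> = (g \<bullet> v)\<^sup>2" using sg(1) by (simp add: power_mult_distrib power2_eq_square)
    finally have "s/4 * (s/4 * norm v)\<^sup>2 \<le> max 0 (s - norm (g - z)) * (g \<bullet> v)\<^sup>2"
      by (intro mult_mono 1) simp_all
    moreover have "s/4 * (s/4 * norm v)\<^sup>2 = (s/4)^3 * (norm v)\<^sup>2"
      by (simp add: power_mult_distrib power2_eq_square power3_eq_cube)
    ultimately show ?thesis using True by simp
  qed simp
  have int: "integrable lborel (\<lambda>g. max 0 (s - norm (g - z)) * (g \<bullet> v)\<^sup>2)"
  proof -
    have "continuous_on (cball z s) (\<lambda>g. max 0 (s - norm (g - z)) * (g \<bullet> v)\<^sup>2)"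
      by (intro continuous_intros)
    then have "set_integrable lborel (cball z s) (\<lambda>g. max 0 (s - norm (g - z)) * (g \<bullet> v)\<^sup>2)"
      by (intro borel_integrable_compact[of "cball z s", unfolded set_integrable_def[symmetric]]) auto
    moreover have "(\<lambda>g. indicator (cball z s) g *\<^sub>R (max 0 (s - norm (g - z)) * (g \<bullet> v)\<^sup>2))
        = (\<lambda>g. max 0 (s - norm (g - z)) * (g \<bullet> v)\<^sup>2)"
      by (rule ext) (auto simp: indicator_def dist_norm norm_minus_commute)
    ultimately show ?thesis unfolding set_integrable_def by metis
  qed
  have "(\<integral>g. indicator (ball c (s/4)) g * ((s/4)^3 * (norm v)\<^sup>2) \<partial>lborel)
      \<le> (\<integral>g. max 0 (s - norm (g - z)) * (g \<bullet> v)\<^sup>2 \<partial>lborel)"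
    using int pt by (intro integral_mono integrable_mult_left integrable_real_indicator)
      (use emeasure_lborel_ball_finite[of c "s/4"] in auto)
  moreover have "measure lborel (ball c (s/4)) = measure lborel (ball (0::'a) (s/4))"
    using s by (simp add: measure_def emeasure_ball)
  ultimately show ?thesis by (simp add: mult_ac bump_def)
qed simp

text \<open>Substituting \<open>h = \<epsilon> *\<^sub>R g\<close> turns the integral of \<open>bump
  z s g * (g \<bullet> b) * (g \<bullet> w (x + \<epsilon> *\<^sub>R g))\<close> over
  \<open>g\<close>, the component along \<open>b\<close> of the vector average, into an integral of
  this kernel at \<open>y - x\<close> against \<open>w y\<close>. The power of
  \<open>1/\<epsilon>\<close> is the Jacobian.\<close>

definition bump_kernel :: "'a::euclidean_space \<Rightarrow> real \<Rightarrow> 'a \<Rightarrow> real \<Rightarrow> 'a \<Rightarrow> 'a" where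
  "bump_kernel z s b \<epsilon> h = ((1/\<epsilon>) ^ DIM('a) * (bump z s (h /\<^sub>R \<epsilon>) * ((h /\<^sub>R \<epsilon>) \<bullet> b))) *\<^sub>R (h /\<^sub>R \<epsilon>)"

lemma borel_measurable_bump_kernel [measurable]:
  "bump_kernel z s b \<epsilon> \<in> borel_measurable borel"
  unfolding bump_kernel_def by measurable

text \<open>The product of bounded Lipschitz factors on a ball. The constant deteriorates as
  \<open>\<epsilon>\<close> tends to 0, which is harmless because each scale counts as a kernel of
  its own. One \<open>K\<close> serves both bounds, as
  \<open>Lipschitz_kernels_convergent_subsequence\<close> expects.\<close>

lemma bump_kernel_bounded_Lipschitz:
  fixes z b :: "'a::euclidean_space"
  assumes b: "b \<in> Basis" and s: "0 < s" and R: "\<And>g. g \<in> ball z s \<Longrightarrow> norm g < R" and eps: "0 < \<epsilon>"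
  shows "\<exists>K. (\<forall>h. norm (bump_kernel z s b \<epsilon> h) \<le> K) \<and>
    (\<forall>h h'. norm (bump_kernel z s b \<epsilon> h - bump_kernel z s b \<epsilon> h') \<le> K * norm (h - h'))"
proof -
  have "norm z < R" using R[of z] s by simp
  then have R0: "R > 0" using le_less_trans[OF norm_ge_zero] by blast
  define F where "F g = (bump z s g * (g \<bullet> b)) *\<^sub>R g" for g
  have gb: "\<bar>g \<bullet> b\<bar> \<le> norm g" for g using Basis_le_norm[OF b] by simp
  have F0: "F g = 0" if "g \<notin> ball z s" for g using bump_eq_0[OF that] by (simp add: F_def)
  have Fb: "norm (F g) \<le> s * R * R" for g
  proof (cases "g \<in> ball z s")
    case True
    have "norm (F g) = bump z s g * \<bar>g \<bullet> b\<bar> * norm g" by (simp add: F_def abs_mult)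
    also have "\<dots> \<le> s * R * R"
      using gb[of g] R[OF True] s by (intro mult_mono bump_le) auto
    finally show ?thesis .
  qed (use F0 s R0 in simp)
  \<comment> \<open>\<open>R * R\<close> accounts for the variation of the bump,
    \<open>2 * s * R\<close> for that of the two linear factors.\<close>
  define K where "K = R * R + 2 * s * R"
  have K0: "K > 0" using R0 s by (simp add: K_def add_pos_pos)
  \<comment> \<open>One point in the ball is enough: if the other lies outside, its bump vanishes
    and the variation of the bump alone gives the estimate.\<close>
  have half: "norm (F g - F h) \<le> K * norm (g - h)" if g: "g \<in> ball z s" for g h
  proof (cases "h \<in> ball z s")
    case True
    have eq: "F g - F h = ((bump z s g - bump z s h) * (g \<bullet> b)) *\<^sub>R g
        + (bump z s h * ((g - h) \<bullet> b)) *\<^sub>R g + (bump z s h * (h \<bullet> b)) *\<^sub>R (g - h)"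
      by (simp add: F_def algebra_simps inner_diff_left)
    have "norm (((bump z s g - bump z s h) * (g \<bullet> b)) *\<^sub>R g) \<le> norm (g - h) * R * R"
      using gb[of g] R[OF g] bump_diff_le[of z s g h] unfolding norm_scaleR abs_mult
      by (intro mult_mono) auto
    moreover have "norm ((bump z s h * ((g - h) \<bullet> b)) *\<^sub>R g) \<le> s * norm (g - h) * R"
      using gb[of "g - h"] R[OF g] s bump_le[of s z h] unfolding norm_scaleR abs_mult
      by (intro mult_mono) auto
    moreover have "norm ((bump z s h * (h \<bullet> b)) *\<^sub>R (g - h)) \<le> s * R * norm (g - h)"
      using gb[of h] R[OF True] s bump_le[of s z h] unfolding norm_scaleR abs_mult
      by (intro mult_mono) auto
    ultimately have "norm (F g - F h) \<le> norm (g - h) * R * R + s * norm (g - h) * R + s * R * norm (g - h)"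
      unfolding eq by (intro norm_triangle_le add_mono) auto
    then show ?thesis by (simp add: K_def algebra_simps)
  next
    case False
    have "norm (F g - F h) = \<bar>bump z s g - bump z s h\<bar> * \<bar>g \<bullet> b\<bar> * norm g"
      using F0[OF False] bump_eq_0[OF False] by (simp add: F_def abs_mult)
    also have "\<dots> \<le> norm (g - h) * R * R"
      using gb[of g] R[OF g] bump_diff_le[of z s g h] by (intro mult_mono) auto
    also have "\<dots> \<le> K * norm (g - h)"
      using s R0 by (simp add: K_def algebra_simps)
    finally show ?thesis .
  qed
  have FL: "norm (F g - F h) \<le> K * norm (g - h)" for g h
  proof -
    consider "g \<in> ball z s" | "h \<in> ball z s" | "g \<notin> ball z s" "h \<notin> ball z s" by blast
    then show ?thesis
    proof cases
      case 1 then show ?thesis by (rule half)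
    next
      case 2 then show ?thesis using half[of h g] by (simp add: norm_minus_commute)
    next
      case 3 then show ?thesis using F0 K0 by simp
    qed
  qed
  define D where "D = (1/\<epsilon>) ^ DIM('a)"
  have D: "D > 0" using eps by (simp add: D_def)
  have BK: "bump_kernel z s b \<epsilon> h = D *\<^sub>R F (h /\<^sub>R \<epsilon>)" for h
    by (simp add: bump_kernel_def F_def D_def)
  have "norm (bump_kernel z s b \<epsilon> h) \<le> D * (s * R * R) + D * K / \<epsilon>" for h
    using Fb[of "h /\<^sub>R \<epsilon>"] D K0 eps by (simp add: BK add_increasing2 mult_left_mono)
  moreover have "norm (bump_kernel z s b \<epsilon> h - bump_kernel z s b \<epsilon> h') \<le> (D * (s * R * R) + D * K / \<epsilon>) * norm (h - h')" for h h'
  proof -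
    have "norm (bump_kernel z s b \<epsilon> h - bump_kernel z s b \<epsilon> h') = D * norm (F (h /\<^sub>R \<epsilon>) - F (h' /\<^sub>R \<epsilon>))"
      using D by (simp add: BK scaleR_diff_right[symmetric] del: scaleR_diff_right)
    also have "\<dots> \<le> D * (K * norm (h /\<^sub>R \<epsilon> - h' /\<^sub>R \<epsilon>))"
      using FL D by (intro mult_left_mono) auto
    also have "norm (h /\<^sub>R \<epsilon> - h' /\<^sub>R \<epsilon>) = norm (h - h') / \<epsilon>"
      using eps by (simp add: scaleR_diff_right[symmetric] divide_inverse del: scaleR_diff_right)
    also have "D * (K * (norm (h - h') / \<epsilon>)) = D * K / \<epsilon> * norm (h - h')" by simp
    also have "\<dots> \<le> (D * (s * R * R) + D * K / \<epsilon>) * norm (h - h')"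
      using D s R0 by (intro mult_right_mono) auto
    finally show ?thesis .
  qed
  ultimately show ?thesis by blast
qed

lemma bump_kernel_integral:
  fixes w :: "'a::euclidean_space \<Rightarrow> 'a"
  assumes [measurable]: "w \<in> borel_measurable borel" and eps: "0 < \<epsilon>"
  shows "(\<integral>y. bump_kernel z s b \<epsilon> (y - x) \<bullet> w y \<partial>lborel)
    = (\<integral>g. bump z s g * (g \<bullet> b) * (g \<bullet> w (x + \<epsilon> *\<^sub>R g)) \<partial>lborel)"
proof -
  have "(\<integral>y. bump_kernel z s b \<epsilon> (y - x) \<bullet> w y \<partial>lborel)
    = \<epsilon> ^ DIM('a) * (\<integral>g. bump_kernel z s b \<epsilon> (x + \<epsilon> *\<^sub>R g - x) \<bullet> w (x + \<epsilon> *\<^sub>R g) \<partial>lborel)"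
    by (rule integral_lborel_affine) (use eps in auto)
  also have "\<dots> = (\<integral>g. \<epsilon> ^ DIM('a) * (bump_kernel z s b \<epsilon> (\<epsilon> *\<^sub>R g) \<bullet> w (x + \<epsilon> *\<^sub>R g)) \<partial>lborel)"
    by simp
  also have "\<dots> = (\<integral>g. bump z s g * (g \<bullet> b) * (g \<bullet> w (x + \<epsilon> *\<^sub>R g)) \<partial>lborel)"
    using eps by (simp add: bump_kernel_def power_one_over)
  finally show ?thesis .
qed

text \<open>The positive definite matrix averaging the products of the coordinates of
  \<open>g\<close> against the bump is tested with \<open>v = w x\<close>. Each component of its
  product with \<open>v\<close> is a kernel average of \<open>w\<close> minus an integral involving
  only \<open>g \<bullet> (w (x + \<epsilon> *\<^sub>R g) - w x)\<close>. The resulting bound is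
  quadratic in \<open>norm v\<close> on the left and linear on the right, so one factor is divided
  out.\<close>

lemma norm_le_bump_kernel:
  fixes w :: "'a::euclidean_space \<Rightarrow> 'a" and R :: real
  assumes s: "0 < s" and R: "\<And>g. g \<in> ball z s \<Longrightarrow> norm g < R"
    and w: "integrable lborel w" and eps: "0 < \<epsilon>"
  shows "(s/4)^3 * measure lborel (ball (0::'a) (s/4)) * norm (w x)
    \<le> (\<Sum>b\<in>Basis. \<bar>\<integral>y. bump_kernel z s b \<epsilon> (y - x) \<bullet> w y \<partial>lborel\<bar>)
      + DIM('a) * (s * R) * (LINT g:ball z s|lborel. \<bar>g \<bullet> (w (x + \<epsilon> *\<^sub>R g) - w x)\<bar>)"
    and "set_integrable lborel (ball z s) (\<lambda>g. \<bar>g \<bullet> (w (x + \<epsilon> *\<^sub>R g) - w x)\<bar>)"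
proof -
  define c where "c = (s/4)^3 * measure lborel (ball (0::'a) (s/4))"
  define v where "v = w x"
  define W where "W g = w (x + \<epsilon> *\<^sub>R g)" for g
  define T where "T = (LINT g:ball z s|lborel. \<bar>g \<bullet> (W g - v)\<bar>)"
  define L where "L b = (\<integral>y. bump_kernel z s b \<epsilon> (y - x) \<bullet> w y \<partial>lborel)" for b
  have [measurable]: "w \<in> borel_measurable borel" using borel_measurable_integrable[OF w] by simp
  have [measurable]: "W \<in> borel_measurable borel" unfolding W_def by measurable
  have [measurable]: "ball z s \<in> sets borel" by simp
  have intW: "integrable lborel W" unfolding W_def by (rule integrable_lborel_affine[OF w eps])
  have "norm z < R" using R[of z] s by simp
  then have R0: "R > 0" using le_less_trans[OF norm_ge_zero] by blast
  have intB: "integrable lborel (indicat_real (ball z s))"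
    using emeasure_lborel_ball_finite[of z s] by (intro integrable_real_indicator) auto
  have bound: "\<bar>g \<bullet> u\<bar> \<le> R * norm u" if "g \<in> ball z s" for g u
  proof -
    have "\<bar>g \<bullet> u\<bar> \<le> norm g * norm u" by (rule Cauchy_Schwarz_ineq2)
    also have "\<dots> \<le> R * norm u" using R[OF that] by (intro mult_right_mono) auto
    finally show ?thesis .
  qed
  have intT: "integrable lborel (\<lambda>g. indicator (ball z s) g *\<^sub>R \<bar>g \<bullet> (W g - v)\<bar>)"
  proof (rule Bochner_Integration.integrable_bound)
    show "integrable lborel (\<lambda>g. R * (norm (W g) + norm v * indicator (ball z s) g))"
      using intW intB by simp
    have "\<bar>indicator (ball z s) g *\<^sub>R \<bar>g \<bullet> (W g - v)\<bar>\<bar> \<le> R * (norm (W g) + norm v * indicator (ball z s) g)" for g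
    proof (cases "g \<in> ball z s")
      case True
      have "\<bar>g \<bullet> (W g - v)\<bar> \<le> R * norm (W g - v)" by (rule bound[OF True])
      also have "\<dots> \<le> R * (norm (W g) + norm v)" using R0 by (intro mult_left_mono norm_triangle_ineq4) auto
      finally show ?thesis using True by simp
    qed (use R0 in simp)
    then show "AE g in lborel. norm (indicator (ball z s) g *\<^sub>R \<bar>g \<bullet> (W g - v)\<bar>)
        \<le> norm (R * (norm (W g) + norm v * indicator (ball z s) g))"
      using abs_ge_self order_trans by (intro AE_I2) (simp del: real_scaleR_def, blast)
  qed measurable
  then show "set_integrable lborel (ball z s) (\<lambda>g. \<bar>g \<bullet> (w (x + \<epsilon> *\<^sub>R g) - w x)\<bar>)"
    by (simp add: set_integrable_def W_def v_def)
  have gb: "\<bar>g \<bullet> b\<bar> \<le> norm g" if "b \<in> Basis" for g b :: 'a using Basis_le_norm[OF that] by simp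
  have bb: "\<bar>bump z s g * (g \<bullet> b) * (g \<bullet> u)\<bar> \<le> s * R * (indicator (ball z s) g * \<bar>g \<bullet> u\<bar>)"
    if b: "b \<in> Basis" for g u and b :: 'a
  proof (cases "g \<in> ball z s")
    case True
    have "\<bar>bump z s g * (g \<bullet> b) * (g \<bullet> u)\<bar> \<le> s * R * \<bar>g \<bullet> u\<bar>"
      unfolding abs_mult using bump_le[of s z g] s gb[OF b, of g] R[OF True] by (intro mult_mono) auto
    then show ?thesis using True by simp
  qed (simp add: bump_eq_0)
  have int1: "integrable lborel (\<lambda>g. bump z s g * (g \<bullet> b) * (g \<bullet> (W g - v)))" if b: "b \<in> Basis" for b
  proof (rule Bochner_Integration.integrable_bound)
    show "integrable lborel (\<lambda>g. s * R * (indicator (ball z s) g *\<^sub>R \<bar>g \<bullet> (W g - v)\<bar>))"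
      using intT by (intro integrable_mult_right)
    show "AE g in lborel. norm (bump z s g * (g \<bullet> b) * (g \<bullet> (W g - v)))
        \<le> norm (s * R * (indicator (ball z s) g *\<^sub>R \<bar>g \<bullet> (W g - v)\<bar>))"
      using bb[OF b] s R0 by (intro AE_I2) (simp add: abs_mult)
  qed measurable
  have int2: "integrable lborel (\<lambda>g. bump z s g * (g \<bullet> b) * (g \<bullet> v))" if b: "b \<in> Basis" for b
  proof (rule Bochner_Integration.integrable_bound)
    show "integrable lborel (\<lambda>g. s * R * (R * norm v) * indicator (ball z s) g)"
      using intB by simp
    have "\<bar>bump z s g * (g \<bullet> b) * (g \<bullet> v)\<bar> \<le> s * R * (R * norm v) * indicator (ball z s) g" for g
    proof (cases "g \<in> ball z s")
      case True
      have "\<bar>bump z s g * (g \<bullet> b) * (g \<bullet> v)\<bar> \<le> s * R * \<bar>g \<bullet> v\<bar>"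
        using bb[OF b, of g v] True by simp
      also have "\<dots> \<le> s * R * (R * norm v)"
        using s R0 by (intro mult_left_mono bound[OF True]) auto
      finally show ?thesis using True by simp
    qed (simp add: bump_eq_0)
    then show "AE g in lborel. norm (bump z s g * (g \<bullet> b) * (g \<bullet> v))
        \<le> norm (s * R * (R * norm v) * indicator (ball z s) g)"
      using s R0 by (intro AE_I2) (simp add: abs_mult)
  qed measurable
  have comp: "\<bar>\<integral>g. bump z s g * (g \<bullet> b) * (g \<bullet> v) \<partial>lborel\<bar> \<le> \<bar>L b\<bar> + s * R * T" if b: "b \<in> Basis" for b
  proof -
    have "L b = (\<integral>g. bump z s g * (g \<bullet> b) * (g \<bullet> v) + bump z s g * (g \<bullet> b) * (g \<bullet> (W g - v)) \<partial>lborel)"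
      unfolding L_def bump_kernel_integral[OF \<open>w \<in> borel_measurable borel\<close> eps] W_def[symmetric]
      by (simp add: inner_diff_right algebra_simps)
    also have "\<dots> = (\<integral>g. bump z s g * (g \<bullet> b) * (g \<bullet> v) \<partial>lborel)
        + (\<integral>g. bump z s g * (g \<bullet> b) * (g \<bullet> (W g - v)) \<partial>lborel)"
      using int1[OF b] int2[OF b] by simp
    finally have 1: "L b = (\<integral>g. bump z s g * (g \<bullet> b) * (g \<bullet> v) \<partial>lborel)
        + (\<integral>g. bump z s g * (g \<bullet> b) * (g \<bullet> (W g - v)) \<partial>lborel)" .
    have "\<bar>\<integral>g. bump z s g * (g \<bullet> b) * (g \<bullet> (W g - v)) \<partial>lborel\<bar>
        \<le> (\<integral>g. \<bar>bump z s g * (g \<bullet> b) * (g \<bullet> (W g - v))\<bar> \<partial>lborel)" by (rule integral_abs_bound)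
    also have "\<dots> \<le> (\<integral>g. s * R * (indicator (ball z s) g *\<^sub>R \<bar>g \<bullet> (W g - v)\<bar>) \<partial>lborel)"
      using int1[OF b] intT bb[OF b] by (intro integral_mono integrable_mult_right) auto
    also have "\<dots> = s * R * T"
      unfolding T_def set_lebesgue_integral_def by (rule integral_mult_right_zero)
    finally show ?thesis using 1 by linarith
  qed
  have "c * (norm v)\<^sup>2 \<le> (\<integral>g. bump z s g * (g \<bullet> v)\<^sup>2 \<partial>lborel)"
    unfolding c_def by (rule bump_quadratic_form_lower_bound[OF s])
  \<comment> \<open>Expanding one factor \<open>g \<bullet> v\<close> in the basis produces the
    components of the matrix applied to \<open>v\<close>, to which \<open>comp\<close>
    applies.\<close>
  also have "\<dots> = (\<integral>g. (\<Sum>b\<in>Basis. (v \<bullet> b) * (bump z s g * (g \<bullet> b) * (g \<bullet> v))) \<partial>lborel)"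
  proof (rule Bochner_Integration.integral_cong[OF refl])
    fix g
    have "bump z s g * (g \<bullet> v)\<^sup>2 = bump z s g * (g \<bullet> v) * (\<Sum>b\<in>Basis. (g \<bullet> b) * (v \<bullet> b))"
      by (simp add: euclidean_inner[of g v] power2_eq_square)
    then show "bump z s g * (g \<bullet> v)\<^sup>2 = (\<Sum>b\<in>Basis. (v \<bullet> b) * (bump z s g * (g \<bullet> b) * (g \<bullet> v)))"
      by (simp add: sum_distrib_left mult_ac)
  qed
  also have "\<dots> = (\<Sum>b\<in>Basis. (v \<bullet> b) * (\<integral>g. bump z s g * (g \<bullet> b) * (g \<bullet> v) \<partial>lborel))"
    using int2 by (subst Bochner_Integration.integral_sum) auto
  also have "\<dots> \<le> (\<Sum>b\<in>Basis. norm v * (\<bar>L b\<bar> + s * R * T))"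
  proof (rule sum_mono)
    fix b :: 'a assume b: "b \<in> Basis"
    have "(v \<bullet> b) * (\<integral>g. bump z s g * (g \<bullet> b) * (g \<bullet> v) \<partial>lborel)
        \<le> \<bar>v \<bullet> b\<bar> * \<bar>\<integral>g. bump z s g * (g \<bullet> b) * (g \<bullet> v) \<partial>lborel\<bar>"
      by (simp add: abs_mult[symmetric])
    also have "\<dots> \<le> norm v * (\<bar>L b\<bar> + s * R * T)"
      using gb[OF b, of v] comp[OF b] by (intro mult_mono) auto
    finally show "(v \<bullet> b) * (\<integral>g. bump z s g * (g \<bullet> b) * (g \<bullet> v) \<partial>lborel) \<le> norm v * (\<bar>L b\<bar> + s * R * T)" .
  qed
  also have "\<dots> = norm v * ((\<Sum>b\<in>Basis. \<bar>L b\<bar>) + DIM('a) * (s * R) * T)"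
    by (simp add: sum_distrib_left[symmetric] sum.distrib)
  finally have key: "norm v * (c * norm v) \<le> norm v * ((\<Sum>b\<in>Basis. \<bar>L b\<bar>) + DIM('a) * (s * R) * T)"
    by (simp add: power2_eq_square mult_ac)
  have T0: "T \<ge> 0" unfolding T_def set_lebesgue_integral_def
    by (intro integral_nonneg_AE AE_I2) (auto simp: indicator_def)
  have "c * norm v \<le> (\<Sum>b\<in>Basis. \<bar>L b\<bar>) + DIM('a) * (s * R) * T"
  proof (cases "v = 0")
    case True
    then show ?thesis using T0 s R0 by (simp add: sum_nonneg)
  next
    case False
    then show ?thesis using key by simp
  qed
  then show "(s/4)^3 * measure lborel (ball (0::'a) (s/4)) * norm (w x)
    \<le> (\<Sum>b\<in>Basis. \<bar>\<integral>y. bump_kernel z s b \<epsilon> (y - x) \<bullet> w y \<partial>lborel\<bar>)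
      + DIM('a) * (s * R) * (LINT g:ball z s|lborel. \<bar>g \<bullet> (w (x + \<epsilon> *\<^sub>R g) - w x)\<bar>)"
    by (simp add: c_def v_def L_def T_def W_def)
qed

section \<open>Geometry of the domain and the multiscale energy\<close>

text \<open>At an interior point any direction will do. At a boundary point the set lies above a
  Lipschitz graph, so directions close to a multiple of \<open>e\<close> point into it: the height
  gained along \<open>g\<close> is at least the rise of the graph. Norms between
  \<open>R / 2\<close> and \<open>R\<close> make the dyadic dilates of the directions fall into
  disjoint annuli.\<close>

lemma bounded_lipschitz_domain_cone:
  fixes \<Omega> :: "'a::euclidean_space set"
  assumes dom: "bounded_lipschitz_domain \<Omega>" and x0: "x0 \<in> closure \<Omega>"
  obtains U z s R where "open U" "x0 \<in> U" "0 < s" "0 < R"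
    "\<And>g. g \<in> ball z s \<Longrightarrow> R / 2 < norm g \<and> norm g < R"
    "\<And>x g l. x \<in> \<Omega> \<inter> U \<Longrightarrow> g \<in> ball z s \<Longrightarrow> 0 < l \<Longrightarrow> l \<le> 1 \<Longrightarrow> x + l *\<^sub>R g \<in> \<Omega>"
proof -
  have annulus: "R / 2 < norm g \<and> norm g < R"
    if "g \<in> ball ((3/4 * R) *\<^sub>R e) s" "s \<le> R / 4" "norm e = 1" "R > 0" for g e :: 'a and R s
  proof -
    have "norm (g - (3/4 * R) *\<^sub>R e) < R / 4" using that(1,2) by (simp add: dist_norm norm_minus_commute)
    moreover have "norm ((3/4 * R) *\<^sub>R e) = 3/4 * R" using that(3,4) by simp
    ultimately show ?thesis
      using norm_triangle_ineq2[of "(3/4 * R) *\<^sub>R e" g] norm_triangle_ineq2[of g "(3/4 * R) *\<^sub>R e"]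
      by (auto simp: norm_minus_commute)
  qed
  \<comment> \<open>The local description of the domain is available on a ball of radius
    \<open>r\<close>; with \<open>R = r / 2\<close>, displacements shorter than \<open>R\<close>
    that start in \<open>ball x0 R\<close> do not leave it.\<close>
  have step: "x + l *\<^sub>R g \<in> ball x0 (2 * R)"
    if "x \<in> ball x0 R" "norm g < R" "0 < l" "l \<le> 1" for x g R l
  proof -
    have "norm (l *\<^sub>R g) \<le> norm g" using that by (simp add: mult_left_le_one_le)
    then have "norm ((x0 - x) - l *\<^sub>R g) < R + R"
      using that norm_triangle_ineq4[of "x0 - x" "l *\<^sub>R g"] by (auto simp: dist_norm)
    then show ?thesis by (simp add: dist_norm algebra_simps)
  qed
  have "open \<Omega>" using dom by (simp add: bounded_lipschitz_domain_def)
  show ?thesis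
  proof (cases "x0 \<in> \<Omega>")
    case True
    obtain e :: 'a where e: "norm e = 1" using nonempty_Basis norm_Basis by blast
    obtain r where r: "r > 0" "ball x0 r \<subseteq> \<Omega>"
      using \<open>open \<Omega>\<close> True openE by blast
    define R where "R = r / 2"
    have R: "R > 0" "2 * R = r" using r by (auto simp: R_def)
    show ?thesis
    proof (rule that[of "ball x0 R" "R/4" R "(3/4 * R) *\<^sub>R e"])
      fix g assume "g \<in> ball ((3/4 * R) *\<^sub>R e) (R/4)"
      then show ann: "R / 2 < norm g \<and> norm g < R" using annulus[of g R e "R/4"] e R by simp
      fix x l assume "x \<in> \<Omega> \<inter> ball x0 R" "0 < (l::real)" "l \<le> 1"
      then show "x + l *\<^sub>R g \<in> \<Omega>" using step[of x R g l] ann R r by auto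
    qed (use R in auto)
  next
    case False
    then have "x0 \<in> frontier \<Omega>" using x0 \<open>open \<Omega>\<close> by (simp add: frontier_def interior_open)
    then obtain r e \<gamma> L where r: "r > 0" "norm e = 1"
      and lip: "\<And>z w. \<bar>\<gamma> z - \<gamma> w\<bar> \<le> L * norm (z - w)"
      and graph: "\<Omega> \<inter> ball x0 r = {x \<in> ball x0 r. x \<bullet> e > \<gamma> (x - (x \<bullet> e) *\<^sub>R e)}"
      using dom unfolding bounded_lipschitz_domain_def lipschitz_boundary_def by meson
    define R where "R = r / 2"
    \<comment> \<open>The part of \<open>g\<close> orthogonal to \<open>e\<close> has norm at most
      \<open>2 * s\<close>, and its height is at least \<open>3/4 * R - s\<close>. This
      \<open>s\<close> makes \<open>2 * (\<bar>L\<bar> * s)\<close> equal to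
      \<open>R / 4 - s\<close>, so the height dominates the change of the graph.\<close>
    define s where "s = R / (4 * (1 + 2 * \<bar>L\<bar>))"
    have R: "R > 0" "2 * R = r" using r by (auto simp: R_def)
    have den: "4 * (1 + 2 * \<bar>L\<bar>) > 0" by simp
    have s: "s > 0" using R den unfolding s_def by (intro divide_pos_pos)
    have "s * (4 * (1 + 2 * \<bar>L\<bar>)) = R" using den by (simp add: s_def)
    then have sR: "4 * s + 8 * (\<bar>L\<bar> * s) = R" by (simp add: algebra_simps)
    have "0 \<le> \<bar>L\<bar> * s" using s by simp
    then have s4: "s \<le> R / 4" using sR by simp
    show ?thesis
    proof (rule that[of "ball x0 R" s R "(3/4 * R) *\<^sub>R e"])
      fix g assume g: "g \<in> ball ((3/4 * R) *\<^sub>R e) s"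
      show ann: "R / 2 < norm g \<and> norm g < R" using annulus[OF g s4] r R by simp
      fix x and l :: real assume x: "x \<in> \<Omega> \<inter> ball x0 R" and l: "0 < l" "l \<le> 1"
      define k where "k = g - (3/4 * R) *\<^sub>R e"
      have k: "norm k < s" using g by (simp add: k_def dist_norm norm_minus_commute)
      have ee: "e \<bullet> e = 1" using r(2) by (simp add: norm_eq_1)
      have ge: "g = k + (3/4 * R) *\<^sub>R e" by (simp add: k_def)
      have ke: "\<bar>k \<bullet> e\<bar> \<le> norm k" using Cauchy_Schwarz_ineq2[of k e] r(2) by simp
      define P where "P y = y - (y \<bullet> e) *\<^sub>R e" for y
      have Pg: "P g = k - (k \<bullet> e) *\<^sub>R e"
        unfolding P_def ge by (simp add: inner_add_left ee algebra_simps)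
      have "norm (P g) \<le> norm k + norm ((k \<bullet> e) *\<^sub>R e)"
        unfolding Pg by (rule norm_triangle_ineq4)
      also have "\<dots> \<le> 2 * s" using ke k r(2) by simp
      finally have "norm (P g) \<le> 2 * s" .
      have Padd: "P (x + l *\<^sub>R g) = P x + l *\<^sub>R P g"
        by (simp add: P_def inner_add_left algebra_simps)
      have "\<gamma> (P (x + l *\<^sub>R g)) - \<gamma> (P x) \<le> L * (l * norm (P g))"
        using lip[of "P (x + l *\<^sub>R g)" "P x"] l by (simp add: Padd)
      also have "\<dots> \<le> \<bar>L\<bar> * (l * (2 * s))"
        using \<open>norm (P g) \<le> 2 * s\<close> l by (intro mult_mono) auto
      also have "\<dots> = l * (2 * (\<bar>L\<bar> * s))" by simp
      also have "\<dots> \<le> l * (g \<bullet> e)"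
      proof (rule mult_left_mono)
        show "2 * (\<bar>L\<bar> * s) \<le> g \<bullet> e"
          using ke k sR s4 s by (simp add: ge inner_add_left ee)
      qed (use l in simp)
      finally have "\<gamma> (P (x + l *\<^sub>R g)) \<le> \<gamma> (P x) + l * (g \<bullet> e)" by simp
      moreover have "x \<in> ball x0 r" using x R by auto
      then have "\<gamma> (P x) < x \<bullet> e" using x graph unfolding P_def by blast
      moreover have "x + l *\<^sub>R g \<in> ball x0 r" using step[of x R g l] x l ann R by auto
      ultimately have "x + l *\<^sub>R g \<in> {x \<in> ball x0 r. x \<bullet> e > \<gamma> (P x)}"
        by (simp add: inner_add_left)
      then show "x + l *\<^sub>R g \<in> \<Omega>" using graph unfolding P_def by blast
    qed (use R s in auto)
  qed
qed

text \<open>Were the weights summable, splitting a ball of radius \<open>R / 2 ^ n\<close> into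
  dyadic shells and using the monotonicity on each shell would bound the integral of
  \<open>\<rho>\<close> over the ball by a constant times the \<open>p\<close>-th power of its
  radius, against \<open>rho_lim\<close>.\<close>

lemma dyadic_kernel_sum_unbounded:
  fixes \<rho> :: "'a::euclidean_space \<Rightarrow> real"
  assumes p: "0 < p" and rho_nonneg: "\<And>\<xi>. 0 \<le> \<rho> \<xi>"
    and rho_loc_int: "\<And>K. compact K \<Longrightarrow> set_integrable lborel K \<rho>"
    and rho_mono: "\<And>\<xi> \<eta>. \<xi> \<noteq> 0 \<Longrightarrow> norm \<xi> \<le> norm \<eta> \<Longrightarrow>
                      \<rho> \<eta> / norm \<eta> powr p \<le> \<rho> \<xi> / norm \<xi> powr p"
    and rho_ball_pos: "eventually (\<lambda>\<delta>. (LINT \<xi>:ball 0 \<delta>|lborel. \<rho> \<xi>) > 0) (at_right 0)"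
    and rho_lim: "((\<lambda>\<delta>. \<delta> powr p / (LINT \<xi>:ball 0 \<delta>|lborel. \<rho> \<xi>)) \<longlongrightarrow> 0) (at_right 0)"
    and e: "norm e = 1" and R: "0 < R"
  shows "\<exists>J. B < (\<Sum>j<J. (1 / 2 ^ j) ^ DIM('a) * (\<rho> ((R / 2 ^ j) *\<^sub>R e) / (R / 2 ^ j) powr p))"
proof (rule ccontr)
  define \<kappa> where "\<kappa> t = \<rho> (t *\<^sub>R e) / t powr p" for t
  define b where "b j = (1 / 2 ^ j) ^ DIM('a) * \<kappa> (R / 2 ^ j)" for j :: nat
  assume "\<not> ?thesis"
  then have bd: "(\<Sum>j<J. b j) \<le> B" for J by (auto simp: b_def \<kappa>_def not_less)
  have e0: "e \<noteq> 0" using e by auto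
  have \<kappa>0: "\<kappa> t \<ge> 0" for t using rho_nonneg by (simp add: \<kappa>_def)
  have b0: "b j \<ge> 0" for j using \<kappa>0 by (simp add: b_def)
  have sum: "summable b" using b0 bd by (rule summableI_nonneg_bounded)
  \<comment> \<open>Volume of a ball of radius \<open>2 * R\<close>: the factor 2 passes from the
    outer radius of a shell, which bounds its volume, to the inner radius, at which the weight is
    taken.\<close>
  define V where "V = unit_ball_vol (DIM('a)) * (2 * R) ^ DIM('a)"
  have V0: "V \<ge> 0" using R by (simp add: V_def)
  define C where "C = V * suminf b"
  have C0: "C \<ge> 0" using V0 suminf_nonneg[OF sum b0] by (simp add: C_def)
  have main: "(LINT \<xi>:ball 0 (R / 2 ^ n)|lborel. \<rho> \<xi>) \<le> C * (R / 2 ^ n) powr p" for n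
  proof -
    define \<delta> where "\<delta> = R / 2 ^ n"
    have \<delta>: "\<delta> > 0" using R by (simp add: \<delta>_def)
    \<comment> \<open>Bound for \<open>\<rho>\<close> on the shell with inner radius
      \<open>R / 2 ^ (j + n + 1)\<close>: the quotient is largest there, and
      \<open>norm \<xi> powr p\<close> is at most \<open>\<delta> powr p\<close>.\<close>
    define c where "c j = \<kappa> (R / 2 ^ (j + n + 1)) * \<delta> powr p" for j
    have c0: "c j \<ge> 0" for j using \<kappa>0 by (simp add: c_def)
    have sum': "summable (\<lambda>j. b (j + (n + 1)))" using sum by (rule summable_ignore_initial_segment)
    have "set_integrable lborel (ball 0 \<delta>) \<rho>"
      by (rule set_integrable_subset[OF rho_loc_int[of "cball 0 \<delta>"]]) auto
    then have "ennreal (LINT \<xi>:ball 0 \<delta>|lborel. \<rho> \<xi>)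
        = (\<integral>\<^sup>+\<xi>. ennreal (indicator (ball 0 \<delta>) \<xi> *\<^sub>R \<rho> \<xi>) \<partial>lborel)"
      unfolding set_lebesgue_integral_def set_integrable_def using rho_nonneg
      by (intro nn_integral_eq_integral[symmetric]) (auto simp: indicator_def)
    also have "\<dots> \<le> (\<integral>\<^sup>+\<xi>. (\<Sum>j. ennreal (c j) * indicator (ball (0::'a) (R / 2 ^ (j + n))) \<xi>) \<partial>lborel)"
    proof (rule nn_integral_mono_AE)
      \<comment> \<open>The origin lies in none of the shells and is discarded as a null
        set.\<close>
      have "AE \<xi> in lborel. \<xi> \<noteq> (0::'a)" by (rule AE_lborel_singleton)
      then show "AE \<xi> in lborel. ennreal (indicator (ball 0 \<delta>) \<xi> *\<^sub>R \<rho> \<xi>)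
          \<le> (\<Sum>j. ennreal (c j) * indicator (ball (0::'a) (R / 2 ^ (j + n))) \<xi>)"
      proof eventually_elim
        case (elim \<xi>)
        show ?case
        proof (cases "\<xi> \<in> ball 0 \<delta>")
          case True
          have ex: "\<exists>j. R / 2 ^ (j + n + 1) \<le> norm \<xi>"
          proof -
            obtain m where "(1/2::real) ^ m < norm \<xi> / R"
              using real_arch_pow_inv[of "norm \<xi> / R" "1/2"] elim R by auto
            then have m: "R * (1/2) ^ m < norm \<xi>" using R by (simp add: field_simps)
            have "R / 2 ^ (m + n + 1) \<le> R / 2 ^ m"
              using R by (intro divide_left_mono power_increasing) auto
            also have "\<dots> = R * (1/2) ^ m" by (simp add: power_divide)
            finally have "R / 2 ^ (m + n + 1) \<le> norm \<xi>" using m by simp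
            then show ?thesis ..
          qed
          define j where "j = (LEAST j. R / 2 ^ (j + n + 1) \<le> norm \<xi>)"
          have j1: "R / 2 ^ (j + n + 1) \<le> norm \<xi>" unfolding j_def by (rule LeastI_ex[OF ex])
          have j2: "norm \<xi> < R / 2 ^ (j + n)"
          proof (cases j)
            case 0
            then show ?thesis using True by (simp add: \<delta>_def)
          next
            case (Suc i)
            then have "i < j" by simp
            then have "\<not> R / 2 ^ (i + n + 1) \<le> norm \<xi>" unfolding j_def by (rule not_less_Least)
            then show ?thesis using Suc by simp
          qed
          have "\<rho> \<xi> / norm \<xi> powr p \<le> \<kappa> (R / 2 ^ (j + n + 1))"
            using rho_mono[of "(R / 2 ^ (j + n + 1)) *\<^sub>R e" \<xi>] j1 e e0 R by (auto simp: \<kappa>_def)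
          then have "\<rho> \<xi> \<le> \<kappa> (R / 2 ^ (j + n + 1)) * norm \<xi> powr p"
            using elim by (simp add: field_simps)
          also have "\<dots> \<le> c j"
            unfolding c_def using True p \<kappa>0 by (intro mult_left_mono powr_mono2) auto
          finally have "ennreal (indicator (ball 0 \<delta>) \<xi> *\<^sub>R \<rho> \<xi>) \<le> ennreal (c j) * indicator (ball (0::'a) (R / 2 ^ (j + n))) \<xi>"
            using True j2 by (simp add: ennreal_leI)
          also have "\<dots> \<le> (\<Sum>j. ennreal (c j) * indicator (ball (0::'a) (R / 2 ^ (j + n))) \<xi>)"
          proof -
            have "f j \<le> suminf f" for f :: "nat \<Rightarrow> ennreal"
              using sum_le_suminf[of f "{j}"] by simp
            then show ?thesis .
          qed
          finally show ?thesis .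
        qed simp
      qed
    qed
    also have "\<dots> = (\<Sum>j. \<integral>\<^sup>+\<xi>. ennreal (c j) * indicator (ball (0::'a) (R / 2 ^ (j + n))) \<xi> \<partial>lborel)"
      by (intro nn_integral_suminf borel_measurable_times_ennreal borel_measurable_indicator) auto
    also have "\<dots> \<le> (\<Sum>j. ennreal (\<delta> powr p * V * b (j + (n + 1))))"
    proof (intro suminf_le allI)
      fix j
      have "(\<integral>\<^sup>+\<xi>. ennreal (c j) * indicator (ball (0::'a) (R / 2 ^ (j + n))) \<xi> \<partial>lborel)
        = ennreal (c j) * ennreal (unit_ball_vol (DIM('a)) * (R / 2 ^ (j + n)) ^ DIM('a))"
        using R by (subst nn_integral_cmult_indicator) (simp_all add: emeasure_ball)
      also have "\<dots> = ennreal (c j * (unit_ball_vol (DIM('a)) * (R / 2 ^ (j + n)) ^ DIM('a)))"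
        using c0 R by (simp add: ennreal_mult)
      also have "c j * (unit_ball_vol (DIM('a)) * (R / 2 ^ (j + n)) ^ DIM('a)) = \<delta> powr p * V * b (j + (n + 1))"
      proof -
        have "R / 2 ^ (j + n) = (2 * R) * (1 / 2 ^ (j + (n + 1)))" by simp
        then show ?thesis by (simp only: c_def b_def V_def power_mult_distrib) simp
      qed
      finally show "(\<integral>\<^sup>+\<xi>. ennreal (c j) * indicator (ball (0::'a) (R / 2 ^ (j + n))) \<xi> \<partial>lborel)
        \<le> ennreal (\<delta> powr p * V * b (j + (n + 1)))" by simp
    qed auto
    also have "\<dots> = ennreal (\<Sum>j. \<delta> powr p * V * b (j + (n + 1)))"
      using sum' b0 V0 by (intro suminf_ennreal2 summable_mult) auto
    also have "(\<Sum>j. \<delta> powr p * V * b (j + (n + 1))) = \<delta> powr p * V * (\<Sum>j. b (j + (n + 1)))"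
      using sum' by (rule suminf_mult)
    also have "ennreal (\<delta> powr p * V * (\<Sum>j. b (j + (n + 1)))) \<le> ennreal (\<delta> powr p * V * suminf b)"
    proof (intro ennreal_leI mult_left_mono)
      show "(\<Sum>j. b (j + (n + 1))) \<le> suminf b"
        using suminf_split_initial_segment[OF sum, of "n + 1"] sum_nonneg[of "{..<n+1}" b] b0 by simp
    qed (use V0 in auto)
    finally have "(LINT \<xi>:ball 0 \<delta>|lborel. \<rho> \<xi>) \<le> \<delta> powr p * V * suminf b"
      using V0 suminf_nonneg[OF sum b0] by (subst (asm) ennreal_le_iff) auto
    then show ?thesis by (simp add: C_def \<delta>_def mult_ac)
  qed
  have lim: "filterlim (\<lambda>n. R / 2 ^ n) (at_right 0) sequentially"
    using LIMSEQ_divide_realpow_zero[of 2 R] R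
    by (intro tendsto_imp_filterlim_at_right) auto
  \<comment> \<open>\<open>C\<close> may be 0, hence \<open>C + 1\<close>. Positivity of the
    integral is recorded next to this bound because a quotient with denominator 0 is 0 and would
    satisfy it trivially.\<close>
  have "\<forall>\<^sub>F \<delta> in at_right 0. \<delta> powr p / (LINT \<xi>:ball 0 \<delta>|lborel. \<rho> \<xi>) < 1 / (C + 1)"
    using rho_lim C0 by (intro order_tendstoD) auto
  with rho_ball_pos have "\<forall>\<^sub>F \<delta> in at_right 0. (LINT \<xi>:ball 0 \<delta>|lborel. \<rho> \<xi>) > 0
      \<and> \<delta> powr p / (LINT \<xi>:ball 0 \<delta>|lborel. \<rho> \<xi>) < 1 / (C + 1)"
    by (rule eventually_conj)
  then have "\<forall>\<^sub>F n in sequentially. (LINT \<xi>:ball 0 (R / 2 ^ n)|lborel. \<rho> \<xi>) > 0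
      \<and> (R / 2 ^ n) powr p / (LINT \<xi>:ball 0 (R / 2 ^ n)|lborel. \<rho> \<xi>) < 1 / (C + 1)"
    using lim by (rule eventually_compose_filterlim)
  then obtain n where n: "(LINT \<xi>:ball 0 (R / 2 ^ n)|lborel. \<rho> \<xi>) > 0"
      "(R / 2 ^ n) powr p / (LINT \<xi>:ball 0 (R / 2 ^ n)|lborel. \<rho> \<xi>) < 1 / (C + 1)"
    by (auto simp: eventually_sequentially)
  then have "(R / 2 ^ n) powr p * (C + 1) < (LINT \<xi>:ball 0 (R / 2 ^ n)|lborel. \<rho> \<xi>)"
    using C0 by (simp add: field_simps)
  moreover have "0 \<le> (R / 2 ^ n) powr p" by simp
  ultimately show False using main[of n] by (simp add: algebra_simps)
qed

text \<open>What matters is the order of the quantifiers: \<open>K\<close> is fixed before the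
  function, the scale and the point, so the number of scales can later be chosen from
  \<open>K\<close>. The estimate is stated in \<open>ennreal\<close> because the error integral of
  p-th powers may be infinite.\<close>

lemma powr_norm_le_bump_kernel:
  fixes z :: "'a::euclidean_space" and R p :: real
  assumes p: "1 \<le> p" and s: "0 < s" and R: "\<And>g. g \<in> ball z s \<Longrightarrow> norm g < R"
  obtains K where "0 < K" "\<And>w \<epsilon> x. integrable lborel w \<Longrightarrow> 0 < \<epsilon> \<Longrightarrow>
    ennreal (norm (w x) powr p) \<le> ennreal K *
      ((\<Sum>b\<in>Basis. ennreal (\<bar>\<integral>y. bump_kernel z s b \<epsilon> (y - x) \<bullet> w y \<partial>lborel\<bar> powr p))
        + (\<integral>\<^sup>+g\<in>ball z s. ennreal (\<bar>g \<bullet> (w (x + \<epsilon> *\<^sub>R g) - w x)\<bar> powr p) \<partial>lborel))"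
proof -
  define c where "c = (s/4)^3 * measure lborel (ball (0::'a) (s/4))"
  have "measure lborel (ball (0::'a) (s/4)) > 0" using content_ball_gt_0_iff[of "0::'a" "s/4"] s by simp
  then have c: "c > 0" using s by (simp add: c_def)
  have "norm z < R" using R[of z] s by simp
  then have R0: "R > 0" using le_less_trans[OF norm_ge_zero] by blast
  define d where "d = real DIM('a) * (s * R)"
  have d: "d > 0" using s R0 by (simp add: d_def)
  define k where "k = 2 * (1 + measure lborel (ball z s))"
  have k: "k > 0" by (auto simp: k_def intro: add_pos_nonneg)
  define K1 where "K1 = real DIM('a) powr p"
  define K2 where "K2 = d powr p * k powr p"
  have K12: "K1 > 0" "K2 \<ge> 0" by (auto simp: K1_def K2_def)
  define K where "K = (2 / c) powr p * (K1 + K2)"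
  show ?thesis
  proof (rule that[of K])
    show "0 < K" using c K12 by (simp add: K_def add_pos_nonneg)
    fix w :: "'a \<Rightarrow> 'a" and \<epsilon> :: real and x
    assume w: "integrable lborel w" and eps: "0 < \<epsilon>"
    define L where "L b = (\<integral>y. bump_kernel z s b \<epsilon> (y - x) \<bullet> w y \<partial>lborel)" for b
    define T where "T = (LINT g:ball z s|lborel. \<bar>g \<bullet> (w (x + \<epsilon> *\<^sub>R g) - w x)\<bar>)"
    define E where "E = (\<integral>\<^sup>+g\<in>ball z s. ennreal (\<bar>g \<bullet> (w (x + \<epsilon> *\<^sub>R g) - w x)\<bar> powr p) \<partial>lborel)"
    have nl: "c * norm (w x) \<le> (\<Sum>b\<in>Basis. \<bar>L b\<bar>) + d * T"
      unfolding c_def d_def L_def T_def by (rule norm_le_bump_kernel(1)[OF s _ w eps]) (rule R)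
    have int: "set_integrable lborel (ball z s) (\<lambda>g. \<bar>g \<bullet> (w (x + \<epsilon> *\<^sub>R g) - w x)\<bar>)"
      by (rule norm_le_bump_kernel(2)[OF s _ w eps]) (rule R)
    have T0: "T \<ge> 0" unfolding T_def set_lebesgue_integral_def
      by (intro integral_nonneg_AE AE_I2) (auto simp: indicator_def)
    have "ennreal (T powr p) \<le> ennreal (k powr p) * E"
      unfolding T_def E_def k_def
      by (rule powr_integral_le[OF p int]) (use emeasure_lborel_ball_finite[of z s] in auto)
    then have TE: "ennreal (d powr p * T powr p) \<le> ennreal K2 * E"
      unfolding K2_def by (simp add: ennreal_mult mult.assoc mult_left_mono)
    have SL: "(\<Sum>b\<in>(Basis::'a set). \<bar>L b\<bar>) powr p \<le> K1 * (\<Sum>b\<in>(Basis::'a set). \<bar>L b\<bar> powr p)"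
      unfolding K1_def by (rule powr_sum_le) (use p in auto)
    have "(c * norm (w x)) powr p \<le> ((\<Sum>b\<in>Basis. \<bar>L b\<bar>) + d * T) powr p"
      using c p nl by (intro powr_mono2) auto
    also have "\<dots> \<le> 2 powr p * ((\<Sum>b\<in>Basis. \<bar>L b\<bar>) powr p + (d * T) powr p)"
      using p d T0 by (intro powr_add_le sum_nonneg) auto
    also have "\<dots> \<le> 2 powr p * (K1 * (\<Sum>b\<in>Basis. \<bar>L b\<bar> powr p) + d powr p * T powr p)"
      using SL d T0 by (intro mult_left_mono add_mono) (auto simp: powr_mult)
    finally have 1: "(c * norm (w x)) powr p \<le> 2 powr p * (K1 * (\<Sum>b\<in>Basis. \<bar>L b\<bar> powr p) + d powr p * T powr p)" .
    have "norm (w x) powr p = (c * norm (w x)) powr p * (1 / c) powr p"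
      using c by (simp add: powr_mult[symmetric])
    also have "\<dots> \<le> 2 powr p * (K1 * (\<Sum>b\<in>Basis. \<bar>L b\<bar> powr p) + d powr p * T powr p) * (1 / c) powr p"
      using 1 by (intro mult_right_mono) auto
    also have "\<dots> = (2 / c) powr p * (K1 * (\<Sum>b\<in>Basis. \<bar>L b\<bar> powr p) + d powr p * T powr p)"
      using c powr_mult[of 2 "1/c" p] by simp
    finally have "ennreal (norm (w x) powr p) \<le> ennreal ((2 / c) powr p * (K1 * (\<Sum>b\<in>Basis. \<bar>L b\<bar> powr p) + d powr p * T powr p))"
      by (rule ennreal_leI)
    also have "\<dots> = ennreal ((2 / c) powr p) * (ennreal K1 * (\<Sum>b\<in>Basis. ennreal (\<bar>L b\<bar> powr p)) + ennreal (d powr p * T powr p))"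
      using K12 by (simp add: ennreal_mult ennreal_plus sum_nonneg sum_ennreal[symmetric] del: sum_ennreal)
    also have "\<dots> \<le> ennreal ((2 / c) powr p) * (ennreal (K1 + K2) * (\<Sum>b\<in>Basis. ennreal (\<bar>L b\<bar> powr p)) + ennreal (K1 + K2) * E)"
      using K12 by (intro mult_left_mono add_mono mult_right_mono order_trans[OF TE] ennreal_leI) auto
    also have "\<dots> = ennreal K * ((\<Sum>b\<in>Basis. ennreal (\<bar>L b\<bar> powr p)) + E)"
      using K12 unfolding K_def by (subst ennreal_mult) (auto simp: distrib_left mult.assoc simp del: ennreal_plus)
    finally show "ennreal (norm (w x) powr p) \<le> ennreal K *
      ((\<Sum>b\<in>Basis. ennreal (\<bar>\<integral>y. bump_kernel z s b \<epsilon> (y - x) \<bullet> w y \<partial>lborel\<bar> powr p))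
        + (\<integral>\<^sup>+g\<in>ball z s. ennreal (\<bar>g \<bullet> (w (x + \<epsilon> *\<^sub>R g) - w x)\<bar> powr p) \<partial>lborel))"
      by (simp add: L_def E_def)
  qed
qed

lemma sum_disjoint_indicator_mult_le:
  fixes f :: ennreal
  assumes "finite A" "\<And>i j. i \<in> A \<Longrightarrow> j \<in> A \<Longrightarrow> i \<noteq> j \<Longrightarrow> S i \<inter> S j = {}"
  shows "(\<Sum>i\<in>A. f * indicator (S i) x) \<le> f"
proof -
  have "indicator (\<Union>i\<in>A. S i) x = (\<Sum>i\<in>A. indicator (S i) x :: ennreal)"
    using assms by (intro indicator_UN_disjoint) (auto simp: disjoint_family_on_def)
  then have "(\<Sum>i\<in>A. f * indicator (S i) x) = f * indicator (\<Union>i\<in>A. S i) x"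
    by (simp only: sum_distrib_left[symmetric])
  also have "\<dots> \<le> f" by (simp add: indicator_def)
  finally show ?thesis .
qed

text \<open>The annuli \<open>R/2^(j+1) < norm h < R/2^j\<close> are disjoint, so the scales \<open>1/2^j\<close> use disjoint parts
  of the seminorm.\<close>
lemma multiscale_energy_le:
  fixes w :: "'a::euclidean_space \<Rightarrow> 'a" and \<rho> :: "'a \<Rightarrow> real"
  assumes p: "1 \<le> p"
    and rho: "\<And>\<xi>. 0 \<le> \<rho> \<xi>" "\<rho> \<in> borel_measurable borel"
    and rho_mono: "\<And>\<xi> \<eta>. \<xi> \<noteq> 0 \<Longrightarrow> norm \<xi> \<le> norm \<eta> \<Longrightarrow>
                      \<rho> \<eta> / norm \<eta> powr p \<le> \<rho> \<xi> / norm \<xi> powr p"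
    and w: "w \<in> borel_measurable borel" and sets: "\<Omega> \<in> sets borel" "U \<in> sets borel" "U \<subseteq> \<Omega>"
    and R: "0 < R" "\<And>g. g \<in> ball z s \<Longrightarrow> R / 2 < norm g \<and> norm g < R" and e: "norm e = 1"
    and cone: "\<And>x g l. x \<in> U \<Longrightarrow> g \<in> ball z s \<Longrightarrow> 0 < l \<Longrightarrow> l \<le> 1 \<Longrightarrow> x + l *\<^sub>R g \<in> \<Omega>"
  shows "(\<Sum>j<J. ennreal ((1 / 2 ^ j) ^ DIM('a) * (\<rho> ((R / 2 ^ j) *\<^sub>R e) / (R / 2 ^ j) powr p)) *
      (\<integral>\<^sup>+x\<in>U. (\<integral>\<^sup>+g\<in>ball z s. ennreal (\<bar>g \<bullet> (w (x + (1 / 2 ^ j) *\<^sub>R g) - w x)\<bar> powr p) \<partial>lborel) \<partial>lborel))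
    \<le> ennreal (R powr p) *
      (\<integral>\<^sup>+x\<in>\<Omega>. (\<integral>\<^sup>+y\<in>\<Omega>. ennreal (\<rho> (y - x) * \<bar>proj_diff_quot w x y\<bar> powr p) \<partial>lborel) \<partial>lborel)"
proof -
  note [measurable] = rho(2) w sets(1,2)
  have [measurable]: "ball z s \<in> sets borel" by simp
  define b where "b j = (1 / 2 ^ j) ^ DIM('a) * (\<rho> ((R / 2 ^ j) *\<^sub>R e) / (R / 2 ^ j) powr p)" for j :: nat
  define I where "I j x = (\<integral>\<^sup>+g\<in>ball z s. ennreal (\<bar>g \<bullet> (w (x + (1 / 2 ^ j) *\<^sub>R g) - w x)\<bar> powr p) \<partial>lborel)" for j :: nat and x
  define F where "F x y = ennreal (\<rho> (y - x) * \<bar>proj_diff_quot w x y\<bar> powr p) * indicator \<Omega> y" for x y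
  have [measurable]: "I j \<in> borel_measurable borel" for j
    unfolding I_def by measurable
  have [measurable]: "(\<lambda>(x,y). F x y) \<in> borel_measurable (borel \<Otimes>\<^sub>M borel)"
    unfolding F_def proj_diff_quot_def by measurable
  have F1[measurable]: "F x \<in> borel_measurable borel" for x
    unfolding F_def proj_diff_quot_def by measurable
  define S where "S j = {h::'a. R / 2 ^ (Suc j) < norm h \<and> norm h < R / 2 ^ j}" for j :: nat
  have S_ord: "S i \<inter> S j = {}" if "i < j" for i j
  proof -
    have "(2::real) ^ Suc i \<le> 2 ^ j" using that by (intro power_increasing) auto
    then have "R / 2 ^ j \<le> R / 2 ^ Suc i" using R(1) by (intro divide_left_mono) auto
    then show ?thesis unfolding S_def by force
  qed
  then have S_disj: "S i \<inter> S j = {}" if "i \<noteq> j" for i j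
    using that by (metis inf_commute linorder_neq_iff)
  have [measurable]: "S j \<in> sets borel" for j unfolding S_def by measurable
  \<comment> \<open>Both factors of the weight are spent here: the dimension power is the Jacobian
    of \<open>y = x + \<epsilon> *\<^sub>R g\<close>, and the kernel quotient is compared with
    \<open>\<rho>\<close> at \<open>y - x\<close>.\<close>
  have inner: "ennreal (b j) * I j x \<le> ennreal (R powr p) * (\<integral>\<^sup>+y. F x y * indicator (S j) (y - x) \<partial>lborel)"
    if x: "x \<in> U" for j x
  proof -
    define \<epsilon> :: real where "\<epsilon> = 1 / 2 ^ j"
    have eps: "0 < \<epsilon>" "\<epsilon> \<le> 1" by (auto simp: \<epsilon>_def)
    define \<kappa> where "\<kappa> = \<rho> ((R / 2 ^ j) *\<^sub>R e) / (R / 2 ^ j) powr p"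
    have \<kappa>0: "\<kappa> \<ge> 0" using rho(1) by (simp add: \<kappa>_def)
    have pt: "ennreal \<kappa> * (ennreal (\<bar>g \<bullet> (w (x + \<epsilon> *\<^sub>R g) - w x)\<bar> powr p) * indicator (ball z s) g)
        \<le> ennreal (R powr p) * (F x (x + \<epsilon> *\<^sub>R g) * indicator (S j) (x + \<epsilon> *\<^sub>R g - x))" for g
    proof (cases "g \<in> ball z s")
      case True
      define D where "D = w (x + \<epsilon> *\<^sub>R g) - w x"
      have g: "R / 2 < norm g" "norm g < R" using R(2)[OF True] by auto
      then have g0: "norm g > 0" using R(1) by linarith
      then have "g \<noteq> 0" by auto
      have inS: "\<epsilon> *\<^sub>R g \<in> S j" using g by (simp add: S_def \<epsilon>_def field_simps)
      have in\<Omega>: "x + \<epsilon> *\<^sub>R g \<in> \<Omega>" using cone[OF x True eps] .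
      \<comment> \<open>The weight is taken at the outer radius of the annulus, so monotonicity
        bounds it by the quotient at the shorter vector
        \<open>\<epsilon> *\<^sub>R g\<close>.\<close>
      have "\<kappa> \<le> \<rho> (\<epsilon> *\<^sub>R g) / norm (\<epsilon> *\<^sub>R g) powr p"
        using rho_mono[of "\<epsilon> *\<^sub>R g" "(R / 2 ^ j) *\<^sub>R e"] g eps \<open>g \<noteq> 0\<close> e R(1)
        by (simp add: \<kappa>_def \<epsilon>_def field_simps)
      then have \<kappa>1: "\<kappa> * (\<epsilon> * norm g) powr p \<le> \<rho> (\<epsilon> *\<^sub>R g)"
        using g0 eps by (simp add: field_simps)
      have pd: "\<bar>proj_diff_quot w x (x + \<epsilon> *\<^sub>R g)\<bar> = \<bar>g \<bullet> D\<bar> / (\<epsilon> * (norm g * norm g))"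
        using eps g0 by (simp add: proj_diff_quot_def D_def[symmetric] abs_mult power2_eq_square inner_commute)
      \<comment> \<open>The projected difference is the quotient times
        \<open>\<epsilon> * (norm g * norm g)\<close>. One factor \<open>norm g\<close> is replaced
        by \<open>R\<close>; the rest, raised to the power \<open>p\<close>, cancels the denominator
        in the quotient of \<open>\<rho>\<close>.\<close>
      have "\<bar>g \<bullet> D\<bar> \<le> R * (\<epsilon> * norm g) * \<bar>proj_diff_quot w x (x + \<epsilon> *\<^sub>R g)\<bar>"
      proof -
        have "R * (\<epsilon> * norm g) * \<bar>proj_diff_quot w x (x + \<epsilon> *\<^sub>R g)\<bar> = (R / norm g) * \<bar>g \<bullet> D\<bar>"
          using eps g0 by (simp add: pd)
        moreover have "1 * \<bar>g \<bullet> D\<bar> \<le> (R / norm g) * \<bar>g \<bullet> D\<bar>"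
          using g g0 by (intro mult_right_mono) auto
        ultimately show ?thesis by simp
      qed
      then have "\<bar>g \<bullet> D\<bar> powr p \<le> (R * (\<epsilon> * norm g) * \<bar>proj_diff_quot w x (x + \<epsilon> *\<^sub>R g)\<bar>) powr p"
        using p by (intro powr_mono2) auto
      also have "\<dots> = R powr p * ((\<epsilon> * norm g) powr p * \<bar>proj_diff_quot w x (x + \<epsilon> *\<^sub>R g)\<bar> powr p)"
        using R(1) eps by (simp add: powr_mult mult.assoc)
      finally have "\<kappa> * \<bar>g \<bullet> D\<bar> powr p
          \<le> \<kappa> * (R powr p * ((\<epsilon> * norm g) powr p * \<bar>proj_diff_quot w x (x + \<epsilon> *\<^sub>R g)\<bar> powr p))"
        using \<kappa>0 by (rule mult_left_mono)
      also have "\<dots> = R powr p * (\<kappa> * (\<epsilon> * norm g) powr p * \<bar>proj_diff_quot w x (x + \<epsilon> *\<^sub>R g)\<bar> powr p)"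
        by simp
      also have "\<dots> \<le> R powr p * (\<rho> (\<epsilon> *\<^sub>R g) * \<bar>proj_diff_quot w x (x + \<epsilon> *\<^sub>R g)\<bar> powr p)"
        using \<kappa>1 by (intro mult_left_mono mult_right_mono) auto
      finally have "ennreal (\<kappa> * \<bar>g \<bullet> D\<bar> powr p)
          \<le> ennreal (R powr p * (\<rho> (\<epsilon> *\<^sub>R g) * \<bar>proj_diff_quot w x (x + \<epsilon> *\<^sub>R g)\<bar> powr p))"
        by (rule ennreal_leI)
      then show ?thesis
        using True inS in\<Omega> \<kappa>0 rho(1) by (simp add: F_def D_def ennreal_mult)
    qed simp
    have "ennreal (b j) * I j x = ennreal (\<epsilon> ^ DIM('a)) *
        (\<integral>\<^sup>+g. ennreal \<kappa> * (ennreal (\<bar>g \<bullet> (w (x + \<epsilon> *\<^sub>R g) - w x)\<bar> powr p) * indicator (ball z s) g) \<partial>lborel)"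
    proof -
      have "ennreal (b j) = ennreal (\<epsilon> ^ DIM('a)) * ennreal \<kappa>"
        using eps \<kappa>0 by (subst ennreal_mult[symmetric]) (auto simp: b_def \<epsilon>_def \<kappa>_def)
      then show ?thesis by (simp add: I_def nn_integral_cmult \<epsilon>_def mult.assoc)
    qed
    also have "\<dots> \<le> ennreal (\<epsilon> ^ DIM('a)) *
        (\<integral>\<^sup>+g. ennreal (R powr p) * (F x (x + \<epsilon> *\<^sub>R g) * indicator (S j) (x + \<epsilon> *\<^sub>R g - x)) \<partial>lborel)"
      by (intro mult_left_mono nn_integral_mono pt) auto
    also have "\<dots> = (\<integral>\<^sup>+y. ennreal (R powr p) * (F x y * indicator (S j) (y - x)) \<partial>lborel)"
      using eps by (intro nn_integral_lborel_affine[symmetric]) auto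
    also have "\<dots> = ennreal (R powr p) * (\<integral>\<^sup>+y. F x y * indicator (S j) (y - x) \<partial>lborel)"
      by (intro nn_integral_cmult) measurable
    finally show ?thesis .
  qed
  have "(\<Sum>j<J. ennreal (b j) * (\<integral>\<^sup>+x\<in>U. I j x \<partial>lborel))
      = (\<integral>\<^sup>+x. (\<Sum>j<J. ennreal (b j) * (I j x * indicator U x)) \<partial>lborel)"
    by (subst nn_integral_sum) (auto simp: nn_integral_cmult)
  also have "\<dots> \<le> (\<integral>\<^sup>+x. ennreal (R powr p) * ((\<integral>\<^sup>+y. F x y \<partial>lborel) * indicator \<Omega> x) \<partial>lborel)"
  proof (rule nn_integral_mono)
    fix x
    show "(\<Sum>j<J. ennreal (b j) * (I j x * indicator U x))
        \<le> ennreal (R powr p) * ((\<integral>\<^sup>+y. F x y \<partial>lborel) * indicator \<Omega> x)"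
    proof (cases "x \<in> U")
      case True
      have "(\<Sum>j<J. ennreal (b j) * I j x)
          \<le> (\<Sum>j<J. ennreal (R powr p) * (\<integral>\<^sup>+y. F x y * indicator (S j) (y - x) \<partial>lborel))"
        by (intro sum_mono inner True)
      also have "\<dots> = ennreal (R powr p) * (\<integral>\<^sup>+y. (\<Sum>j<J. F x y * indicator (S j) (y - x)) \<partial>lborel)"
        by (subst nn_integral_sum) (auto simp: sum_distrib_left)
      also have "\<dots> \<le> ennreal (R powr p) * (\<integral>\<^sup>+y. F x y \<partial>lborel)"
        using S_disj by (intro mult_left_mono nn_integral_mono sum_disjoint_indicator_mult_le) auto
      finally show ?thesis using True sets(3) by auto
    qed simp
  qed
  also have "\<dots> = ennreal (R powr p) * (\<integral>\<^sup>+x. (\<integral>\<^sup>+y. F x y \<partial>lborel) * indicator \<Omega> x \<partial>lborel)"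
    by (intro nn_integral_cmult) measurable
  finally show ?thesis by (simp add: b_def I_def F_def)
qed

section \<open>The nonlocal energy and compactness\<close>

text \<open>This is \<open>S_seminorm_pow\<close> with \<open>lborel\<close> for
  \<open>lebesgue\<close>. For Borel functions the inner integral is then Borel measurable in
  \<open>x\<close>, as the additivity of the integral and Fatou's lemma require;
  \<open>S_seminorm_pow_eq_nonlocal_energy\<close> leads back.\<close>

definition nonlocal_energy ::
  "('a::euclidean_space \<Rightarrow> real) \<Rightarrow> real \<Rightarrow> 'a set \<Rightarrow> ('a \<Rightarrow> 'a) \<Rightarrow> ennreal" where
  "nonlocal_energy \<rho> p \<Omega> u =
     (\<integral>\<^sup>+x\<in>\<Omega>. (\<integral>\<^sup>+y\<in>\<Omega>. ennreal (\<rho> (y - x) * \<bar>proj_diff_quot u x y\<bar> powr p) \<partial>lborel) \<partial>lborel)"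

section \<open>Differences and lower semicontinuity of the energy\<close>

lemma proj_diff_quot_diff:
  "proj_diff_quot (\<lambda>x. u x - v x) x y = proj_diff_quot u x y - proj_diff_quot v x y"
proof -
  have "u y - v y - (u x - v x) = (u y - u x) - (v y - v x)" by simp
  then show ?thesis by (simp only: proj_diff_quot_def inner_diff_left[symmetric] diff_divide_distrib[symmetric])
qed

lemma nonlocal_energy_diff_le:
  fixes u v :: "'a::euclidean_space \<Rightarrow> 'a"
  assumes [measurable]: "\<rho> \<in> borel_measurable borel" "u \<in> borel_measurable borel"
      "v \<in> borel_measurable borel" "\<Omega> \<in> sets borel"
    and rho: "\<And>\<xi>. 0 \<le> \<rho> \<xi>" and p: "0 \<le> p"
  shows "nonlocal_energy \<rho> p \<Omega> (\<lambda>x. u x - v x)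
    \<le> ennreal (2 powr p) * (nonlocal_energy \<rho> p \<Omega> u + nonlocal_energy \<rho> p \<Omega> v)"
proof -
  define G where "G u x y = ennreal (\<rho> (y - x) * \<bar>proj_diff_quot u x y\<bar> powr p) * indicator \<Omega> y" for u x y
  have pt: "G (\<lambda>x. u x - v x) x y \<le> ennreal (2 powr p) * (G u x y + G v x y)" for x y
  proof -
    have "\<rho> (y - x) * \<bar>proj_diff_quot u x y - proj_diff_quot v x y\<bar> powr p
      \<le> \<rho> (y - x) * (2 powr p * (\<bar>proj_diff_quot u x y\<bar> powr p + \<bar>proj_diff_quot v x y\<bar> powr p))"
      using rho p by (intro mult_left_mono powr_abs_diff_le) auto
    then have "ennreal (\<rho> (y - x) * \<bar>proj_diff_quot u x y - proj_diff_quot v x y\<bar> powr p)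
      \<le> ennreal (2 powr p * (\<rho> (y - x) * \<bar>proj_diff_quot u x y\<bar> powr p + \<rho> (y - x) * \<bar>proj_diff_quot v x y\<bar> powr p))"
      by (intro ennreal_leI) (simp add: algebra_simps)
    also have "\<dots> = ennreal (2 powr p) * (ennreal (\<rho> (y - x) * \<bar>proj_diff_quot u x y\<bar> powr p)
        + ennreal (\<rho> (y - x) * \<bar>proj_diff_quot v x y\<bar> powr p))"
      using rho by (simp add: ennreal_mult)
    finally show ?thesis by (auto simp: G_def proj_diff_quot_diff indicator_def)
  qed
  have Gm[measurable]: "G u x \<in> borel_measurable lborel" "G v x \<in> borel_measurable lborel" for x
    unfolding G_def proj_diff_quot_def by measurable
  have [measurable]: "(\<lambda>x. \<integral>\<^sup>+y. G u x y \<partial>lborel) \<in> borel_measurable borel"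
      "(\<lambda>x. \<integral>\<^sup>+y. G v x y \<partial>lborel) \<in> borel_measurable borel"
    unfolding G_def proj_diff_quot_def by measurable
  have "(\<integral>\<^sup>+x\<in>\<Omega>. (\<integral>\<^sup>+y. G (\<lambda>x. u x - v x) x y \<partial>lborel) \<partial>lborel)
    \<le> (\<integral>\<^sup>+x. ennreal (2 powr p) * ((\<integral>\<^sup>+y. G u x y \<partial>lborel) * indicator \<Omega> x + (\<integral>\<^sup>+y. G v x y \<partial>lborel) * indicator \<Omega> x) \<partial>lborel)"
  proof (rule nn_integral_mono)
    fix x
    have "(\<integral>\<^sup>+y. G (\<lambda>x. u x - v x) x y \<partial>lborel)
        \<le> (\<integral>\<^sup>+y. ennreal (2 powr p) * (G u x y + G v x y) \<partial>lborel)"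
      by (intro nn_integral_mono pt)
    also have "\<dots> = ennreal (2 powr p) * ((\<integral>\<^sup>+y. G u x y \<partial>lborel) + (\<integral>\<^sup>+y. G v x y \<partial>lborel))"
      by (simp add: nn_integral_cmult nn_integral_add)
    finally show "(\<integral>\<^sup>+y. G (\<lambda>x. u x - v x) x y \<partial>lborel) * indicator \<Omega> x
      \<le> ennreal (2 powr p) * ((\<integral>\<^sup>+y. G u x y \<partial>lborel) * indicator \<Omega> x + (\<integral>\<^sup>+y. G v x y \<partial>lborel) * indicator \<Omega> x)"
      by (auto simp: indicator_def)
  qed
  also have "\<dots> = ennreal (2 powr p) * ((\<integral>\<^sup>+x\<in>\<Omega>. (\<integral>\<^sup>+y. G u x y \<partial>lborel) \<partial>lborel) + (\<integral>\<^sup>+x\<in>\<Omega>. (\<integral>\<^sup>+y. G v x y \<partial>lborel) \<partial>lborel))"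
    by (simp add: nn_integral_cmult nn_integral_add)
  finally show ?thesis by (simp add: nonlocal_energy_def G_def)
qed

text \<open>Fatou's lemma is applied twice, in \<open>y\<close> for almost every fixed
  \<open>x\<close> and then in \<open>x\<close>.\<close>

lemma nonlocal_energy_lsc:
  fixes u :: "nat \<Rightarrow> 'a::euclidean_space \<Rightarrow> 'a"
  assumes [measurable]: "\<rho> \<in> borel_measurable borel" "\<And>n. u n \<in> borel_measurable borel" "\<Omega> \<in> sets borel"
    and p: "0 < p" and conv: "AE x in lborel. (\<lambda>n. u n x) \<longlonglongrightarrow> v x"
  shows "nonlocal_energy \<rho> p \<Omega> v \<le> liminf (\<lambda>n. nonlocal_energy \<rho> p \<Omega> (u n))"
proof -
  define G where "G u x y = ennreal (\<rho> (y - x) * \<bar>proj_diff_quot u x y\<bar> powr p) * indicator \<Omega> y" for u x y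
  have Gm[measurable]: "G (u n) x \<in> borel_measurable lborel" for x n
    unfolding G_def proj_diff_quot_def by measurable
  have [measurable]: "(\<lambda>x. \<integral>\<^sup>+y. G (u n) x y \<partial>lborel) \<in> borel_measurable borel" for n
    unfolding G_def proj_diff_quot_def by measurable
  have pt: "G v x y = liminf (\<lambda>n. G (u n) x y)"
    if "(\<lambda>n. u n x) \<longlonglongrightarrow> v x" "(\<lambda>n. u n y) \<longlonglongrightarrow> v y" for x y
  proof -
    \<comment> \<open>The denominator does not depend on \<open>n\<close>; as a constant factor it
      also covers \<open>x = y\<close>, where its inverse is 0.\<close>
    have "(\<lambda>n. proj_diff_quot (u n) x y) \<longlonglongrightarrow> proj_diff_quot v x y"
      unfolding proj_diff_quot_def divide_inverse by (intro tendsto_intros that)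
    then have "(\<lambda>n. \<rho> (y - x) * \<bar>proj_diff_quot (u n) x y\<bar> powr p) \<longlonglongrightarrow> \<rho> (y - x) * \<bar>proj_diff_quot v x y\<bar> powr p"
      using p by (intro tendsto_mult tendsto_const tendsto_powr' tendsto_rabs) auto
    then have "(\<lambda>n. ennreal (\<rho> (y - x) * \<bar>proj_diff_quot (u n) x y\<bar> powr p)) \<longlonglongrightarrow> ennreal (\<rho> (y - x) * \<bar>proj_diff_quot v x y\<bar> powr p)"
      by (rule tendsto_ennrealI)
    then have "(\<lambda>n. G (u n) x y) \<longlonglongrightarrow> G v x y"
      unfolding G_def by (cases "y \<in> \<Omega>") auto
    then show ?thesis by (rule lim_imp_Liminf[symmetric, rotated]) simp
  qed
  have "(\<integral>\<^sup>+x\<in>\<Omega>. (\<integral>\<^sup>+y. G v x y \<partial>lborel) \<partial>lborel)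
      \<le> (\<integral>\<^sup>+x. liminf (\<lambda>n. (\<integral>\<^sup>+y. G (u n) x y \<partial>lborel) * indicator \<Omega> x) \<partial>lborel)"
  proof (rule nn_integral_mono_AE)
    show "AE x in lborel. (\<integral>\<^sup>+y. G v x y \<partial>lborel) * indicator \<Omega> x
        \<le> liminf (\<lambda>n. (\<integral>\<^sup>+y. G (u n) x y \<partial>lborel) * indicator \<Omega> x)"
      using conv
    proof eventually_elim
      case (elim x)
      have "(\<integral>\<^sup>+y. G v x y \<partial>lborel) = (\<integral>\<^sup>+y. liminf (\<lambda>n. G (u n) x y) \<partial>lborel)"
        using conv by (intro nn_integral_cong_AE) (auto elim!: eventually_mono intro: pt elim)
      also have "\<dots> \<le> liminf (\<lambda>n. \<integral>\<^sup>+y. G (u n) x y \<partial>lborel)"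
        by (rule nn_integral_liminf) measurable
      finally show ?case by (cases "x \<in> \<Omega>") auto
    qed
  qed
  also have "\<dots> \<le> liminf (\<lambda>n. \<integral>\<^sup>+x\<in>\<Omega>. (\<integral>\<^sup>+y. G (u n) x y \<partial>lborel) \<partial>lborel)"
    by (rule nn_integral_liminf) measurable
  finally show ?thesis by (simp add: nonlocal_energy_def G_def)
qed

section \<open>Passage from Lebesgue measurable functions to Borel representatives\<close>

lemma lebesgue_AE_Borel:
  fixes f :: "'a::euclidean_space \<Rightarrow> 'b::euclidean_space"
  assumes "f \<in> borel_measurable lebesgue"
  obtains g where "g \<in> borel_measurable borel" "AE x in lborel. f x = g x"
proof -
  have "\<exists>g\<in>borel_measurable lborel. AE x in lborel. f x \<bullet> b = g x" for b
    using assms by (intro completion_ex_borel_measurable_real) simp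
  then obtain G where G: "\<And>b. G b \<in> borel_measurable lborel" "\<And>b. AE x in lborel. f x \<bullet> b = G b x"
    by metis
  have [measurable]: "G b \<in> borel_measurable borel" for b using G(1) by simp
  show ?thesis
  proof (rule that[of "\<lambda>x. \<Sum>b\<in>Basis. G b x *\<^sub>R b"])
    have "AE x in lborel. \<forall>b\<in>Basis. f x \<bullet> b = G b x"
      using G(2) by (intro AE_finite_allI) auto
    then show "AE x in lborel. f x = (\<Sum>b\<in>Basis. G b x *\<^sub>R b)"
    proof eventually_elim
      case (elim x)
      then have "(\<Sum>b\<in>Basis. G b x *\<^sub>R b) = (\<Sum>b\<in>Basis. (f x \<bullet> b) *\<^sub>R b)" by (intro sum.cong) auto
      then show ?case by (simp add: euclidean_representation)
    qed
  qed measurable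
qed

text \<open>An \<open>nn_integral\<close> over \<open>lebesgue\<close> equals the one over
  \<open>lborel\<close> for any integrand, measurable or not. The rest is invariance under changes
  on a null set, used in \<open>y\<close> inside and in \<open>x\<close> outside.\<close>

lemma S_seminorm_pow_eq_nonlocal_energy:
  assumes "AE x in lborel. x \<in> \<Omega> \<longrightarrow> u x = v x"
  shows "S_seminorm_pow \<rho> p \<Omega> u = nonlocal_energy \<rho> p \<Omega> v"
  unfolding S_seminorm_pow_def nonlocal_energy_def nn_integral_completion
proof (rule nn_integral_cong_AE)
  show "AE x in lborel. (\<integral>\<^sup>+y\<in>\<Omega>. ennreal (\<rho> (y - x) * \<bar>proj_diff_quot u x y\<bar> powr p) \<partial>lborel) * indicator \<Omega> x =
      (\<integral>\<^sup>+y\<in>\<Omega>. ennreal (\<rho> (y - x) * \<bar>proj_diff_quot v x y\<bar> powr p) \<partial>lborel) * indicator \<Omega> x"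
    using assms
  proof eventually_elim
    case (elim x)
    show ?case
    proof (cases "x \<in> \<Omega>")
      case True
      have "(\<integral>\<^sup>+y\<in>\<Omega>. ennreal (\<rho> (y - x) * \<bar>proj_diff_quot u x y\<bar> powr p) \<partial>lborel)
          = (\<integral>\<^sup>+y\<in>\<Omega>. ennreal (\<rho> (y - x) * \<bar>proj_diff_quot v x y\<bar> powr p) \<partial>lborel)"
        using assms
        by (intro nn_integral_cong_AE) (auto elim!: eventually_mono simp: proj_diff_quot_def indicator_def elim True)
      then show ?thesis by simp
    qed simp
  qed
qed

lemma Lp_pow_eq:
  assumes "AE x in lborel. x \<in> \<Omega> \<longrightarrow> u x = v x" "\<And>x. x \<notin> \<Omega> \<Longrightarrow> v x = 0"
  shows "Lp_pow \<Omega> p u = (\<integral>\<^sup>+x. ennreal (norm (v x) powr p) \<partial>lborel)"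
  unfolding Lp_pow_def nn_integral_completion
  using assms by (intro nn_integral_cong_AE) (auto elim!: eventually_mono simp: indicator_def)

text \<open>By \<open>multiscale_energy_le\<close> and the divergence of the weights, every \<open>w i\<close> has a scale \<open>1/2^j\<close>
  with \<open>j < J\<close> at which it is close to its average; only \<open>J\<close>, not \<open>j\<close>, is uniform in \<open>i\<close>,
  and this is enough because there are finitely many scales below \<open>J\<close>.\<close>
lemma local_Lp_tendsto_zero:
  fixes w :: "'i \<Rightarrow> 'a::euclidean_space \<Rightarrow> 'a" and \<rho> :: "'a \<Rightarrow> real"
  assumes p: "1 \<le> p"
    and rho: "\<And>\<xi>. 0 \<le> \<rho> \<xi>" "\<rho> \<in> borel_measurable borel"
    and rho_mono: "\<And>\<xi> \<eta>. \<xi> \<noteq> 0 \<Longrightarrow> norm \<xi> \<le> norm \<eta> \<Longrightarrow>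
                      \<rho> \<eta> / norm \<eta> powr p \<le> \<rho> \<xi> / norm \<xi> powr p"
    and unbounded: "\<And>B. \<exists>J. B < (\<Sum>j<J. (1 / 2 ^ j) ^ DIM('a) * (\<rho> ((R / 2 ^ j) *\<^sub>R e) / (R / 2 ^ j) powr p))"
    and sets: "\<Omega> \<in> sets borel" "U \<in> sets borel"
    and s: "0 < s" and R: "0 < R" "\<And>g. g \<in> ball z s \<Longrightarrow> R / 2 < norm g \<and> norm g < R" and e: "norm e = 1"
    and cone: "\<And>x g l. x \<in> \<Omega> \<inter> U \<Longrightarrow> g \<in> ball z s \<Longrightarrow> 0 < l \<Longrightarrow> l \<le> 1 \<Longrightarrow> x + l *\<^sub>R g \<in> \<Omega>"
    and w: "\<And>i. integrable lborel (w i)" "\<And>i. nonlocal_energy \<rho> p \<Omega> (w i) \<le> ennreal D"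
    and conv: "\<And>b j. b \<in> Basis \<Longrightarrow> ((\<lambda>i. \<integral>\<^sup>+x\<in>\<Omega>. ennreal (\<bar>\<integral>y. bump_kernel z s b (1 / 2 ^ j) (y - x) \<bullet> w i y \<partial>lborel\<bar> powr p) \<partial>lborel) \<longlongrightarrow> 0) F"
  shows "((\<lambda>i. \<integral>\<^sup>+x\<in>\<Omega> \<inter> U. ennreal (norm (w i x) powr p) \<partial>lborel) \<longlongrightarrow> 0) F"
proof -
  note [measurable] = rho(2) sets
  have [measurable]: "w i \<in> borel_measurable borel" for i using borel_measurable_integrable[OF w(1)] by simp
  have [measurable]: "ball z s \<in> sets borel" by simp
  define a where "a j = (1 / 2 ^ j) ^ DIM('a) * (\<rho> ((R / 2 ^ j) *\<^sub>R e) / (R / 2 ^ j) powr p)" for j :: nat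
  have a0: "a j \<ge> 0" for j using rho(1) by (simp add: a_def)
  define G where "G j i x = (\<integral>\<^sup>+g\<in>ball z s. ennreal (\<bar>g \<bullet> (w i (x + (1 / 2 ^ j) *\<^sub>R g) - w i x)\<bar> powr p) \<partial>lborel)" for j :: nat and i x
  have [measurable]: "G j i \<in> borel_measurable borel" for j i unfolding G_def by measurable
  define E where "E j i = (\<integral>\<^sup>+x\<in>\<Omega> \<inter> U. G j i x \<partial>lborel)" for j i
  define L where "L b j i x = (\<integral>y. bump_kernel z s b (1 / 2 ^ j) (y - x) \<bullet> w i y \<partial>lborel)" for b and j :: nat and i x
  have [measurable]: "L b j i \<in> borel_measurable borel" for b j i unfolding L_def by measurable
  define M where "M b j i = (\<integral>\<^sup>+x\<in>\<Omega>. ennreal (\<bar>L b j i x\<bar> powr p) \<partial>lborel)" for b j i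
  define A where "A i = (\<integral>\<^sup>+x\<in>\<Omega> \<inter> U. ennreal (norm (w i x) powr p) \<partial>lborel)" for i
  obtain K where K: "0 < K" "\<And>w \<epsilon> x. integrable lborel w \<Longrightarrow> 0 < \<epsilon> \<Longrightarrow>
    ennreal (norm (w x) powr p) \<le> ennreal K *
      ((\<Sum>b\<in>Basis. ennreal (\<bar>\<integral>y. bump_kernel z s b \<epsilon> (y - x) \<bullet> w y \<partial>lborel\<bar> powr p))
        + (\<integral>\<^sup>+g\<in>ball z s. ennreal (\<bar>g \<bullet> (w (x + \<epsilon> *\<^sub>R g) - w x)\<bar> powr p) \<partial>lborel))"
    by (rule powr_norm_le_bump_kernel[OF p s, of z R]) (use R(2) in auto)
  have AK: "A i \<le> ennreal K * ((\<Sum>b\<in>Basis. M b j i) + E j i)" for i j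
  proof -
    define Q where "Q x = (\<Sum>b\<in>Basis. ennreal (\<bar>L b j i x\<bar> powr p) * indicator \<Omega> x)" for x
    have [measurable]: "Q \<in> borel_measurable borel" unfolding Q_def by measurable
    have Q: "(\<integral>\<^sup>+x. Q x \<partial>lborel) = (\<Sum>b\<in>Basis. M b j i)"
      unfolding Q_def M_def by (intro nn_integral_sum) measurable
    have "A i \<le> (\<integral>\<^sup>+x. ennreal K * (Q x
        + G j i x * indicator (\<Omega> \<inter> U) x) \<partial>lborel)"
      unfolding A_def
    proof (rule nn_integral_mono)
      fix x
      show "ennreal (norm (w i x) powr p) * indicator (\<Omega> \<inter> U) x
        \<le> ennreal K * (Q x + G j i x * indicator (\<Omega> \<inter> U) x)"
        using K(2)[OF w(1)[of i], of "1 / 2 ^ j" x]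
        by (cases "x \<in> \<Omega> \<inter> U") (simp_all add: L_def G_def Q_def)
    qed
    also have "\<dots> = ennreal K * ((\<Sum>b\<in>Basis. M b j i) + E j i)"
      by (simp add: nn_integral_cmult nn_integral_add Q E_def)
    finally show ?thesis .
  qed
  have energy: "(\<Sum>j<J. ennreal (a j) * E j i) \<le> ennreal (R powr p * D)" for J i
  proof -
    have "(\<Sum>j<J. ennreal (a j) * E j i) \<le> ennreal (R powr p) * nonlocal_energy \<rho> p \<Omega> (w i)"
      unfolding a_def E_def G_def nonlocal_energy_def
      by (rule multiscale_energy_le[OF p rho rho_mono _ sets(1) _ _ R(1) _ e])
        (use R(2) cone in auto)
    also have "\<dots> \<le> ennreal (R powr p) * ennreal D" using w(2) by (intro mult_left_mono) auto
    finally show ?thesis by (simp add: ennreal_mult')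
  qed
  have "(A \<longlongrightarrow> 0) F"
  proof (rule order_tendstoI)
    fix c :: ennreal assume "0 < c"
    obtain \<eta> :: real where \<eta>: "\<eta> > 0" "ennreal \<eta> + ennreal \<eta> \<le> c"
    proof (cases c)
      case top
      then show ?thesis using that[of 1] by simp
    next
      case (real x)
      then show ?thesis using \<open>0 < c\<close> that[of "x/2"] by (simp add: ennreal_plus[symmetric] del: ennreal_plus)
    qed
    \<comment> \<open>Chosen for the pigeonhole: if \<open>ennreal K * E j i\<close> exceeded
      \<open>\<eta>\<close> for all \<open>j < J\<close>, the weighted energy bound would give
      \<open>(\<Sum>j<J. a j) * \<eta> \<le> K * (R powr p * \<bar>D\<bar>)\<close>.\<close>
    obtain J where J: "K * (R powr p * \<bar>D\<bar>) / \<eta> < (\<Sum>j<J. a j)"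
      using unbounded unfolding a_def by blast
    have "\<exists>j<J. ennreal K * E j i \<le> ennreal \<eta>" for i
    proof (rule ccontr)
      assume "\<not> ?thesis"
      then have *: "ennreal \<eta> \<le> ennreal K * E j i" if "j < J" for j
        using that by (meson linear)
      have "ennreal ((\<Sum>j<J. a j) * \<eta>) = (\<Sum>j<J. ennreal (a j) * ennreal \<eta>)"
        using a0 \<eta> by (simp add: sum_distrib_right ennreal_mult sum_ennreal[symmetric] del: sum_ennreal)
      also have "\<dots> \<le> (\<Sum>j<J. ennreal (a j) * (ennreal K * E j i))"
        using * by (intro sum_mono mult_left_mono) auto
      also have "\<dots> = ennreal K * (\<Sum>j<J. ennreal (a j) * E j i)"
        by (simp add: sum_distrib_left mult_ac)
      also have "\<dots> \<le> ennreal K * ennreal (R powr p * \<bar>D\<bar>)"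
        by (intro mult_left_mono order_trans[OF energy] ennreal_leI mult_left_mono) auto
      also have "\<dots> = ennreal (K * (R powr p * \<bar>D\<bar>))" using K(1) by (simp add: ennreal_mult)
      finally have "(\<Sum>j<J. a j) * \<eta> \<le> K * (R powr p * \<bar>D\<bar>)"
        using K(1) by (subst (asm) ennreal_le_iff) auto
      then show False using J \<eta>(1) by (simp add: field_simps)
    qed
    then have bound: "A i \<le> ennreal K * (\<Sum>j<J. \<Sum>b\<in>Basis. M b j i) + ennreal \<eta>" for i
    proof -
      obtain j where j: "j < J" "ennreal K * E j i \<le> ennreal \<eta>"
        using \<open>\<And>i. \<exists>j<J. ennreal K * E j i \<le> ennreal \<eta>\<close> by blast
      have "A i \<le> ennreal K * (\<Sum>b\<in>Basis. M b j i) + ennreal K * E j i"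
        using AK[of i j] by (simp add: distrib_left)
      also have "\<dots> \<le> ennreal K * (\<Sum>j<J. \<Sum>b\<in>Basis. M b j i) + ennreal \<eta>"
        using j by (intro add_mono mult_left_mono member_le_sum) auto
      finally show ?thesis .
    qed
    have "((\<lambda>i. \<Sum>j<J. \<Sum>b\<in>(Basis::'a set). M b j i) \<longlongrightarrow> (\<Sum>j<J. \<Sum>b\<in>(Basis::'a set). 0)) F"
      using conv unfolding M_def L_def by (intro tendsto_sum) auto
    then have "((\<lambda>i. ennreal K * (\<Sum>j<J. \<Sum>b\<in>Basis. M b j i)) \<longlongrightarrow> ennreal K * 0) F"
      by (intro ennreal_tendsto_cmult) auto
    then have "((\<lambda>i. ennreal K * (\<Sum>j<J. \<Sum>b\<in>Basis. M b j i)) \<longlongrightarrow> 0) F" by simp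
    then have "\<forall>\<^sub>F i in F. ennreal K * (\<Sum>j<J. \<Sum>b\<in>Basis. M b j i) < ennreal \<eta>"
      by (rule order_tendstoD(2)) (use \<eta> in simp)
    then show "\<forall>\<^sub>F i in F. A i < c"
    proof eventually_elim
      case (elim i)
      have "A i \<le> ennreal K * (\<Sum>j<J. \<Sum>b\<in>Basis. M b j i) + ennreal \<eta>" by (rule bound)
      also have "\<dots> < ennreal \<eta> + ennreal \<eta>"
        using elim by (simp add: ennreal_add_left_cancel_less add.commute)
      finally show ?case using \<eta>(2) by (rule less_le_trans)
    qed
  qed simp
  then show ?thesis by (simp add: A_def[abs_def])
qed

text \<open>Compactness of the closure leaves finitely many patches, hence countably many kernels,
  and one subsequence makes all their averages converge. Differences are indexed by pairs under the
  product filter, so that tending to 0 along it is the Cauchy property.\<close>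

lemma nonlocal_precompact:
  fixes u :: "nat \<Rightarrow> 'a::euclidean_space \<Rightarrow> 'a" and \<rho> :: "'a \<Rightarrow> real"
  assumes p: "1 \<le> p"
    and rho_nonneg: "\<And>\<xi>. 0 \<le> \<rho> \<xi>" and rho_meas: "\<rho> \<in> borel_measurable borel"
    and rho_loc_int: "\<And>K. compact K \<Longrightarrow> set_integrable lborel K \<rho>"
    and rho_mono: "\<And>\<xi> \<eta>. \<xi> \<noteq> 0 \<Longrightarrow> norm \<xi> \<le> norm \<eta> \<Longrightarrow>
                      \<rho> \<eta> / norm \<eta> powr p \<le> \<rho> \<xi> / norm \<xi> powr p"
    and rho_ball_pos: "eventually (\<lambda>\<delta>. (LINT \<xi>:ball 0 \<delta>|lborel. \<rho> \<xi>) > 0) (at_right 0)"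
    and rho_lim: "((\<lambda>\<delta>. \<delta> powr p / (LINT \<xi>:ball 0 \<delta>|lborel. \<rho> \<xi>)) \<longlongrightarrow> 0) (at_right 0)"
    and dom: "bounded_lipschitz_domain \<Omega>"
    and u: "\<And>n. u n \<in> borel_measurable borel" "\<And>n x. x \<notin> \<Omega> \<Longrightarrow> u n x = 0"
      "\<And>n. (\<integral>\<^sup>+x. ennreal (norm (u n x) powr p) \<partial>lborel) \<le> ennreal C"
      "\<And>n. nonlocal_energy \<rho> p \<Omega> (u n) \<le> ennreal C"
  shows "\<exists>(r :: nat \<Rightarrow> nat) v. strict_mono r \<and> v \<in> borel_measurable borel \<and> (\<forall>x. x \<notin> \<Omega> \<longrightarrow> v x = 0) \<and>
    (\<integral>\<^sup>+x. ennreal (norm (v x) powr p) \<partial>lborel) < \<infinity> \<and>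
    (\<lambda>n. \<integral>\<^sup>+x. ennreal (norm (u (r n) x - v x) powr p) \<partial>lborel) \<longlonglongrightarrow> 0"
proof -
  note [measurable] = rho_meas u(1)
  have "open \<Omega>" "bounded \<Omega>" using dom by (auto simp: bounded_lipschitz_domain_def)
  then have \<Omega>[measurable]: "\<Omega> \<in> sets borel" and fin: "emeasure lborel \<Omega> < \<infinity>"
    using emeasure_bounded_finite by auto
  have u3: "(\<integral>\<^sup>+x. ennreal (norm (u n x) powr p) \<partial>lborel) < \<infinity>" for n
    using u(3) by (rule le_less_trans) simp
  have int: "integrable lborel (u n)" for n
    by (rule Lp_imp_integrable(1)[OF p _ fin _ u(2) u3]) auto
  define C1 where "C1 = measure lborel \<Omega> + \<bar>C\<bar>"
  have L1: "(\<integral>y. norm (u n y) \<partial>lborel) \<le> C1" for n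
  proof -
    have "(\<integral>y. norm (u n y) \<partial>lborel) \<le> measure lborel \<Omega> + enn2real (\<integral>\<^sup>+x. ennreal (norm (u n x) powr p) \<partial>lborel)"
      by (rule Lp_imp_integrable(3)[OF p _ fin _ u(2) u3]) auto
    moreover have "enn2real (\<integral>\<^sup>+x. ennreal (norm (u n x) powr p) \<partial>lborel) \<le> \<bar>C\<bar>"
      by (rule enn2real_leI) (auto intro: order_trans[OF u(3)] ennreal_leI)
    ultimately show ?thesis by (simp add: C1_def)
  qed
  define patch where "patch U z s R \<longleftrightarrow> open U \<and> 0 < s \<and> 0 < R \<and>
      (\<forall>g\<in>ball z s. R / 2 < norm g \<and> norm g < R) \<and>
      (\<forall>x\<in>\<Omega> \<inter> U. \<forall>g\<in>ball z s. \<forall>l. 0 < l \<and> l \<le> 1 \<longrightarrow> x + l *\<^sub>R g \<in> \<Omega>)" for U and z :: 'a and s R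
  have "\<exists>U z s R. x0 \<in> U \<and> patch U z s R" if "x0 \<in> closure \<Omega>" for x0
  proof (rule bounded_lipschitz_domain_cone[OF dom that])
    fix U z s R
    assume "open U" "x0 \<in> U" "0 < s" "0 < R"
      "\<And>g. g \<in> ball z s \<Longrightarrow> R / 2 < norm g \<and> norm g < R"
      "\<And>x g l. x \<in> \<Omega> \<inter> U \<Longrightarrow> g \<in> ball z s \<Longrightarrow> 0 < l \<Longrightarrow> l \<le> 1 \<Longrightarrow> x + l *\<^sub>R g \<in> \<Omega>"
    then have "x0 \<in> U \<and> patch U z s R" unfolding patch_def by blast
    then show ?thesis by blast
  qed
  then obtain U z s R where patches: "\<And>t. t \<in> closure \<Omega> \<Longrightarrow> t \<in> U t \<and> patch (U t) (z t) (s t) (R t)"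
    by metis
  have "compact (closure \<Omega>)" using \<open>bounded \<Omega>\<close> by (simp add: compact_closure)
  then obtain T where T: "T \<subseteq> closure \<Omega>" "finite T" "closure \<Omega> \<subseteq> (\<Union>t\<in>T. U t)"
    by (rule compactE_image[of "closure \<Omega>" "closure \<Omega>" U]) (use patches in \<open>auto simp: patch_def\<close>)
  have pt: "open (U t)" "0 < s t" "0 < R t" "\<And>g. g \<in> ball (z t) (s t) \<Longrightarrow> R t / 2 < norm g \<and> norm g < R t"
      "\<And>x g l. x \<in> \<Omega> \<inter> U t \<Longrightarrow> g \<in> ball (z t) (s t) \<Longrightarrow> 0 < l \<Longrightarrow> l \<le> 1 \<Longrightarrow> x + l *\<^sub>R g \<in> \<Omega>" if "t \<in> T" for t
    using patches[of t] T(1) that unfolding patch_def by blast+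
  define I where "I = T \<times> (Basis :: 'a set) \<times> (UNIV :: nat set)"
  define \<Phi> where "\<Phi> = (\<lambda>(t, b, j::nat). bump_kernel (z t) (s t) b (1 / 2 ^ j))"
  have \<Phi>: "\<Phi> (t, b, j) = bump_kernel (z t) (s t) b (1 / 2 ^ j)" for t b j by (simp add: \<Phi>_def)
  have "countable I" unfolding I_def using T(2) by (intro countable_SIGMA) (auto simp: countable_finite)
  have "\<exists>K. (\<forall>h. norm (\<Phi> i h) \<le> K) \<and> (\<forall>h h'. norm (\<Phi> i h - \<Phi> i h') \<le> K * norm (h - h'))" if "i \<in> I" for i
  proof -
    obtain t b j where i1: "i = (t, b, j)" by (cases i)
    have i: "t \<in> T" "b \<in> Basis" using that by (auto simp: i1 I_def)
    show ?thesis unfolding i1 \<Phi>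
      by (rule bump_kernel_bounded_Lipschitz[OF i(2) pt(2)[OF i(1)], of _ "R t"]) (use pt(4)[OF i(1)] in auto)
  qed
  then obtain K where K: "\<And>i h. i \<in> I \<Longrightarrow> norm (\<Phi> i h) \<le> K i"
      "\<And>i h h'. i \<in> I \<Longrightarrow> norm (\<Phi> i h - \<Phi> i h') \<le> K i * norm (h - h')"
    by metis
  obtain r where r1: "strict_mono (r :: nat \<Rightarrow> nat)"
    and r2: "\<forall>i\<in>I. \<forall>x. convergent (\<lambda>n. \<integral>y. \<Phi> i (y - x) \<bullet> u (r n) y \<partial>lborel)"
    using Lipschitz_kernels_convergent_subsequence[where u = u and \<Phi> = \<Phi> and K = K and C = C1,
        OF \<open>countable I\<close> K int L1] by blast
  note r = r1 r2[rule_format]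
  have [measurable]: "\<Phi> i \<in> borel_measurable borel" for i
    by (cases i) (simp add: \<Phi> borel_measurable_bump_kernel)
  define w where "w = (\<lambda>(n, m) x. u (r n) x - u (r m) x)"
  have w: "w (n, m) = (\<lambda>x. u (r n) x - u (r m) x)" for n m by (simp add: w_def)
  let ?F = "sequentially \<times>\<^sub>F sequentially"
  have kernels: "((\<lambda>k. \<integral>\<^sup>+x\<in>\<Omega>. ennreal (\<bar>\<integral>y. \<Phi> i (y - x) \<bullet> w k y \<partial>lborel\<bar> powr p) \<partial>lborel) \<longlongrightarrow> 0) ?F"
    if i: "i \<in> I" for i
  proof (rule order_tendstoI)
    fix c :: ennreal assume c: "0 < c"
    have ik: "integrable lborel (\<lambda>y. \<Phi> i (y - x) \<bullet> u n y)" for x n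
      by (rule bounded_kernel_integrable[OF int _ K(1)[OF i]]) simp
    have K0: "K i \<ge> 0" using K(1)[OF i, of 0] norm_ge_zero order_trans by blast
    have bd: "\<bar>\<integral>y. \<Phi> i (y - x) \<bullet> u (r n) y \<partial>lborel\<bar> \<le> K i * C1" for n x
    proof -
      have "\<bar>\<integral>y. \<Phi> i (y - x) \<bullet> u (r n) y \<partial>lborel\<bar> \<le> K i * (\<integral>y. norm (u (r n) y) \<partial>lborel)"
        by (rule bounded_kernel_integral_le[OF int _ K(1)[OF i]]) simp
      also have "\<dots> \<le> K i * C1" using L1 K0 by (rule mult_left_mono)
      finally show ?thesis .
    qed
    \<comment> \<open>The average of a difference is the difference of the averages, so the
      convergence along \<open>r\<close> yields smallness for both indices large.\<close>
    have "\<exists>N. \<forall>n\<ge>N. \<forall>m\<ge>N. (\<integral>\<^sup>+x\<in>\<Omega>. ennreal (\<bar>(\<integral>y. \<Phi> i (y - x) \<bullet> u (r n) y \<partial>lborel)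
        - (\<integral>y. \<Phi> i (y - x) \<bullet> u (r m) y \<partial>lborel)\<bar> powr p) \<partial>lborel) < c"
      by (rule bounded_convergent_imp_Cauchy_powr[OF _ _ fin _ r(2)[OF i] bd c]) (use p in auto)
    then show "\<forall>\<^sub>F k in ?F. (\<integral>\<^sup>+x\<in>\<Omega>. ennreal (\<bar>\<integral>y. \<Phi> i (y - x) \<bullet> w k y \<partial>lborel\<bar> powr p) \<partial>lborel) < c"
      unfolding eventually_prod_sequentially w inner_diff_right
      by (subst Bochner_Integration.integral_diff[OF ik ik]) blast
  qed simp
  define D where "D = 2 powr p * (\<bar>C\<bar> + \<bar>C\<bar>)"
  have energy: "nonlocal_energy \<rho> p \<Omega> (w k) \<le> ennreal D" for k
  proof -
    obtain n m where k: "k = (n, m)" by (cases k)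
    have "nonlocal_energy \<rho> p \<Omega> (w k)
        \<le> ennreal (2 powr p) * (nonlocal_energy \<rho> p \<Omega> (u (r n)) + nonlocal_energy \<rho> p \<Omega> (u (r m)))"
      unfolding k w by (rule nonlocal_energy_diff_le) (use rho_nonneg p in auto)
    also have "\<dots> \<le> ennreal (2 powr p) * (ennreal \<bar>C\<bar> + ennreal \<bar>C\<bar>)"
      by (intro mult_left_mono add_mono order_trans[OF u(4)] ennreal_leI) auto
    also have "\<dots> = ennreal D"
      by (simp only: D_def ennreal_mult ennreal_plus abs_ge_zero powr_ge_zero add_nonneg_nonneg)
    finally show ?thesis .
  qed
  obtain e :: 'a where e: "norm e = 1" using nonempty_Basis norm_Basis by blast
  have local: "((\<lambda>k. \<integral>\<^sup>+x\<in>\<Omega> \<inter> U t. ennreal (norm (w k x) powr p) \<partial>lborel) \<longlongrightarrow> 0) ?F" if t: "t \<in> T" for t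
  proof (rule local_Lp_tendsto_zero[OF p rho_nonneg rho_meas rho_mono _ \<Omega> _ pt(2,3)[OF t] _ e])
    show "\<exists>J. B < (\<Sum>j<J. (1 / 2 ^ j) ^ DIM('a) * (\<rho> ((R t / 2 ^ j) *\<^sub>R e) / (R t / 2 ^ j) powr p))" for B
      by (rule dyadic_kernel_sum_unbounded[OF _ rho_nonneg rho_loc_int rho_mono rho_ball_pos rho_lim e pt(3)[OF t]])
        (use p in auto)
    show "integrable lborel (w k)" for k
      using int by (cases k) (auto simp: w)
    show "((\<lambda>k. \<integral>\<^sup>+x\<in>\<Omega>. ennreal (\<bar>\<integral>y. bump_kernel (z t) (s t) b (1 / 2 ^ j) (y - x) \<bullet> w k y \<partial>lborel\<bar> powr p) \<partial>lborel) \<longlongrightarrow> 0) ?F"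
      if "b \<in> Basis" for b j
      using kernels[of "(t, b, j)"] t that by (simp add: I_def \<Phi>)
  qed (use pt[OF t] energy in auto)
  have [measurable]: "w k \<in> borel_measurable borel" for k by (cases k) (simp add: w)
  have [measurable]: "U t \<in> sets borel" if "t \<in> T" for t using pt(1)[OF that] by simp
  \<comment> \<open>The patches cover the domain and \<open>w k\<close> vanishes outside it;
    overlaps only enlarge the right-hand side.\<close>
  have global: "(\<integral>\<^sup>+x. ennreal (norm (w k x) powr p) \<partial>lborel)
      \<le> (\<Sum>t\<in>T. \<integral>\<^sup>+x\<in>\<Omega> \<inter> U t. ennreal (norm (w k x) powr p) \<partial>lborel)" for k
  proof -
    have "(\<integral>\<^sup>+x. ennreal (norm (w k x) powr p) \<partial>lborel)
        \<le> (\<integral>\<^sup>+x. (\<Sum>t\<in>T. ennreal (norm (w k x) powr p) * indicator (\<Omega> \<inter> U t) x) \<partial>lborel)"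
    proof (rule nn_integral_mono)
      fix x
      show "ennreal (norm (w k x) powr p) \<le> (\<Sum>t\<in>T. ennreal (norm (w k x) powr p) * indicator (\<Omega> \<inter> U t) x)"
      proof (cases "x \<in> \<Omega>")
        case True
        then obtain t where t: "t \<in> T" "x \<in> U t" using T(3) closure_subset by blast
        have "ennreal (norm (w k x) powr p) = ennreal (norm (w k x) powr p) * indicator (\<Omega> \<inter> U t) x"
          using True t by simp
        also have "\<dots> \<le> (\<Sum>t\<in>T. ennreal (norm (w k x) powr p) * indicator (\<Omega> \<inter> U t) x)"
          using t T(2) by (intro member_le_sum) auto
        finally show ?thesis .
      qed (cases k, simp add: w u(2))
    qed
    also have "\<dots> = (\<Sum>t\<in>T. \<integral>\<^sup>+x\<in>\<Omega> \<inter> U t. ennreal (norm (w k x) powr p) \<partial>lborel)"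
      by (intro nn_integral_sum) measurable
    finally show ?thesis .
  qed
  have "((\<lambda>k. \<Sum>t\<in>T. \<integral>\<^sup>+x\<in>\<Omega> \<inter> U t. ennreal (norm (w k x) powr p) \<partial>lborel) \<longlongrightarrow> (\<Sum>t\<in>T. 0)) ?F"
    using local by (intro tendsto_sum) auto
  then have lim0: "((\<lambda>k. \<Sum>t\<in>T. \<integral>\<^sup>+x\<in>\<Omega> \<inter> U t. ennreal (norm (w k x) powr p) \<partial>lborel) \<longlongrightarrow> 0) ?F" by simp
  have cau: "\<exists>N. \<forall>n\<ge>N. \<forall>m\<ge>N. (\<integral>\<^sup>+x. ennreal (norm (u (r n) x - u (r m) x) powr p) \<partial>lborel) < c" if "0 < c" for c :: ennreal
  proof -
    have "\<forall>\<^sub>F k in ?F. (\<Sum>t\<in>T. \<integral>\<^sup>+x\<in>\<Omega> \<inter> U t. ennreal (norm (w k x) powr p) \<partial>lborel) < c"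
      using lim0 that by (rule order_tendstoD)
    then have "\<forall>\<^sub>F k in ?F. (\<integral>\<^sup>+x. ennreal (norm (w k x) powr p) \<partial>lborel) < c"
      by eventually_elim (rule le_less_trans[OF global])
    then show ?thesis unfolding eventually_prod_sequentially w by blast
  qed
  obtain v where v: "v \<in> borel_measurable lborel" "\<And>x. x \<notin> \<Omega> \<Longrightarrow> v x = 0"
    "(\<integral>\<^sup>+x. ennreal (norm (v x) powr p) \<partial>lborel) < \<infinity>"
    "(\<lambda>n. \<integral>\<^sup>+x. ennreal (norm (u (r n) x - v x) powr p) \<partial>lborel) \<longlonglongrightarrow> 0"
    by (rule Lp_Cauchy_imp_convergent[OF p _ fin, of "\<lambda>n. u (r n)"]) (use u(2) u3 cau in auto)
  show ?thesis using r(1) v by (intro exI[of _ r] exI[of _ v]) simp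
qed

text \<open>The given functions are arbitrary outside the domain and only Lebesgue measurable
  inside, so Borel representatives vanishing outside replace them. The second claim concerns every
  subsequence and every limit; it is proved from the energy bound, independently of the construction
  in the first.\<close>

theorem theorem1p1:
  fixes p :: real and \<rho> :: "'a::euclidean_space \<Rightarrow> real" and \<Omega> :: "'a set"
    and u :: "nat \<Rightarrow> 'a \<Rightarrow> 'a"
  assumes p: "1 \<le> p"
    and rho_nonneg: "\<And>\<xi>. 0 \<le> \<rho> \<xi>"
    and rho_loc_int: "\<And>K. compact K \<Longrightarrow> set_integrable lborel K \<rho>"
    and rho_radial: "\<And>\<xi> \<eta>. norm \<xi> = norm \<eta> \<Longrightarrow> \<rho> \<xi> = \<rho> \<eta>"
    and rho_mono: "\<And>\<xi> \<eta>. \<xi> \<noteq> 0 \<Longrightarrow> norm \<xi> \<le> norm \<eta> \<Longrightarrow>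
                      \<rho> \<eta> / norm \<eta> powr p \<le> \<rho> \<xi> / norm \<xi> powr p"
    and rho_ball_pos: "eventually (\<lambda>\<delta>. (LINT \<xi>:ball 0 \<delta>|lborel. \<rho> \<xi>) > 0) (at_right 0)"
    and rho_lim: "((\<lambda>\<delta>. \<delta> powr p / (LINT \<xi>:ball 0 \<delta>|lborel. \<rho> \<xi>)) \<longlongrightarrow> 0) (at_right 0)"
    and dom: "bounded_lipschitz_domain \<Omega>"
    and u_Lp: "\<And>n. in_Lp \<Omega> p (u n)"
    and u_bdd: "\<exists>C::real. \<forall>n. Lp_pow \<Omega> p (u n) + S_seminorm_pow \<rho> p \<Omega> (u n) \<le> ennreal C"
  shows "(\<exists>r v. strict_mono r \<and> in_Lp \<Omega> p v \<and>
            (\<lambda>n. Lp_pow \<Omega> p (\<lambda>x. u (r n) x - v x)) \<longlonglongrightarrow> 0)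
       \<and> (\<forall>r v. strict_mono r \<and> in_Lp \<Omega> p v \<and>
            (\<lambda>n. Lp_pow \<Omega> p (\<lambda>x. u (r n) x - v x)) \<longlonglongrightarrow> 0
            \<longrightarrow> in_S_space \<rho> p \<Omega> v)"
proof -
  have \<Omega>: "open \<Omega>" "bounded \<Omega>" using dom by (auto simp: bounded_lipschitz_domain_def)
  then have \<Omega>m[measurable]: "\<Omega> \<in> sets borel" and fin: "emeasure lborel \<Omega> < \<infinity>"
    using emeasure_bounded_finite by auto
  \<comment> \<open>Local integrability gives measurability on each ball, and \<open>\<rho>\<close>
    is the pointwise limit of its truncations.\<close>
  have \<rho>m: "\<rho> \<in> borel_measurable borel"
  proof -
    have "(\<lambda>x. indicator (cball 0 (real n)) x *\<^sub>R \<rho> x) \<in> borel_measurable borel" for n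
      using borel_measurable_integrable[OF rho_loc_int[of "cball 0 (real n)", unfolded set_integrable_def]]
      by simp
    moreover have "(\<lambda>n. indicator (cball 0 (real n)) x *\<^sub>R \<rho> x) \<longlonglongrightarrow> \<rho> x" for x
    proof (rule tendsto_eventually)
      obtain N :: nat where "norm x \<le> real N" using real_arch_simple by blast
      then show "\<forall>\<^sub>F n in sequentially. indicator (cball 0 (real n)) x *\<^sub>R \<rho> x = \<rho> x"
        by (auto simp: eventually_sequentially intro!: exI[of _ N])
    qed
    ultimately show ?thesis by (rule borel_measurable_LIMSEQ_metric)
  qed
  have rep: "\<exists>g. g \<in> borel_measurable borel \<and> (\<forall>x. x \<notin> \<Omega> \<longrightarrow> g x = 0)
      \<and> (AE x in lborel. x \<in> \<Omega> \<longrightarrow> f x = g x)" if f: "in_Lp \<Omega> p f" for f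
  proof -
    have "(\<lambda>x. indicator \<Omega> x *\<^sub>R f x) \<in> borel_measurable lebesgue"
      using f by (simp add: in_Lp_def set_borel_measurable_def)
    then obtain g where [measurable]: "g \<in> borel_measurable borel"
        and g: "AE x in lborel. indicator \<Omega> x *\<^sub>R f x = g x"
      by (rule lebesgue_AE_Borel)
    have "AE x in lborel. x \<in> \<Omega> \<longrightarrow> f x = indicator \<Omega> x *\<^sub>R g x"
      using g by eventually_elim auto
    then show ?thesis by (intro exI[of _ "\<lambda>x. indicator \<Omega> x *\<^sub>R g x"]) auto
  qed
  have "\<forall>n. \<exists>g. g \<in> borel_measurable borel \<and> (\<forall>x. x \<notin> \<Omega> \<longrightarrow> g x = 0)
      \<and> (AE x in lborel. x \<in> \<Omega> \<longrightarrow> u n x = g x)"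
    using rep[OF u_Lp] by (rule allI)
  from choice[OF this] obtain u' where "\<forall>n. u' n \<in> borel_measurable borel \<and> (\<forall>x. x \<notin> \<Omega> \<longrightarrow> u' n x = 0)
      \<and> (AE x in lborel. x \<in> \<Omega> \<longrightarrow> u n x = u' n x)" ..
  then have u': "\<And>n. u' n \<in> borel_measurable borel" "\<And>n x. x \<notin> \<Omega> \<Longrightarrow> u' n x = 0"
      "\<And>n. AE x in lborel. x \<in> \<Omega> \<longrightarrow> u n x = u' n x"
    by simp_all
  obtain C where C: "\<And>n. Lp_pow \<Omega> p (u n) + S_seminorm_pow \<rho> p \<Omega> (u n) \<le> ennreal C"
    using u_bdd by blast
  have Lp_le: "(\<integral>\<^sup>+x. ennreal (norm (u' n x) powr p) \<partial>lborel) \<le> ennreal C" for n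
    using order_trans[OF add_increasing2[OF zero_le order_refl] C] Lp_pow_eq[OF u'(3) u'(2)] by simp
  have energy_le: "nonlocal_energy \<rho> p \<Omega> (u' n) \<le> ennreal C" for n
    using order_trans[OF add_increasing[OF zero_le order_refl] C] S_seminorm_pow_eq_nonlocal_energy[OF u'(3)] by simp
  have "\<exists>r v. strict_mono r \<and> in_Lp \<Omega> p v \<and> (\<lambda>n. Lp_pow \<Omega> p (\<lambda>x. u (r n) x - v x)) \<longlonglongrightarrow> 0"
  proof -
    obtain r v where r: "strict_mono (r :: nat \<Rightarrow> nat)" and v: "v \<in> borel_measurable borel" "\<forall>x. x \<notin> \<Omega> \<longrightarrow> v x = 0"
        "(\<integral>\<^sup>+x. ennreal (norm (v x) powr p) \<partial>lborel) < \<infinity>"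
        "(\<lambda>n. \<integral>\<^sup>+x. ennreal (norm (u' (r n) x - v x) powr p) \<partial>lborel) \<longlonglongrightarrow> 0"
      using nonlocal_precompact[where u = u' and C = C, OF p rho_nonneg \<rho>m rho_loc_int rho_mono
          rho_ball_pos rho_lim dom u'(1,2) Lp_le energy_le] by blast
    have "Lp_pow \<Omega> p v = (\<integral>\<^sup>+x. ennreal (norm (v x) powr p) \<partial>lborel)"
      using v(2) by (intro Lp_pow_eq) auto
    moreover have "set_borel_measurable lebesgue \<Omega> v"
      using v(1) unfolding set_borel_measurable_def by (intro measurable_completion) measurable
    ultimately have "in_Lp \<Omega> p v" using v(3) by (simp add: in_Lp_def)
    moreover have "Lp_pow \<Omega> p (\<lambda>x. u (r n) x - v x) = (\<integral>\<^sup>+x. ennreal (norm (u' (r n) x - v x) powr p) \<partial>lborel)" for n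
      using u'(3)[of "r n"] u'(2) v(2) by (intro Lp_pow_eq) (auto elim!: eventually_mono)
    ultimately show ?thesis using r v(4) by (intro exI[of _ r] exI[of _ v]) simp
  qed
  moreover have "in_S_space \<rho> p \<Omega> v"
    if r: "strict_mono r" and v: "in_Lp \<Omega> p v" and lim: "(\<lambda>n. Lp_pow \<Omega> p (\<lambda>x. u (r n) x - v x)) \<longlonglongrightarrow> 0" for r v
  proof -
    obtain v' where v': "v' \<in> borel_measurable borel" "\<And>x. x \<notin> \<Omega> \<Longrightarrow> v' x = 0"
        "AE x in lborel. x \<in> \<Omega> \<longrightarrow> v x = v' x"
      using rep[OF v] by blast
    note [measurable] = u'(1) v'(1)
    have "Lp_pow \<Omega> p (\<lambda>x. u (r n) x - v x) = (\<integral>\<^sup>+x. ennreal (norm (u' (r n) x - v' x) powr p) \<partial>lborel)" for n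
    proof (rule Lp_pow_eq)
      show "AE x in lborel. x \<in> \<Omega> \<longrightarrow> u (r n) x - v x = u' (r n) x - v' x"
        using u'(3)[of "r n"] v'(3) by eventually_elim auto
    qed (simp add: u'(2) v'(2))
    with lim have "(\<lambda>n. \<integral>\<^sup>+x. ennreal (norm (u' (r n) x - v' x) powr p) \<partial>lborel) \<longlonglongrightarrow> 0" by simp
    \<comment> \<open>Convergence in L^p gives almost everywhere convergence only along a further
      subsequence; this suffices, since the energy bound holds for every member.\<close>
    then obtain q where q: "strict_mono (q :: nat \<Rightarrow> nat)" "AE x in lborel. (\<lambda>n. u' (r (q n)) x - v' x) \<longlonglongrightarrow> 0"
      using Lp_tendsto_imp_AE_subseq[OF p _ fin, of "\<lambda>n x. u' (r n) x - v' x"] u'(2) v'(2) by auto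
    have "AE x in lborel. (\<lambda>n. u' (r (q n)) x) \<longlonglongrightarrow> v' x"
      using q(2) by eventually_elim (rule LIM_zero_cancel)
    then have "nonlocal_energy \<rho> p \<Omega> v' \<le> liminf (\<lambda>n. nonlocal_energy \<rho> p \<Omega> (u' (r (q n))))"
      using p by (intro nonlocal_energy_lsc \<rho>m u'(1) \<Omega>m) auto
    also have "\<dots> \<le> limsup (\<lambda>n. nonlocal_energy \<rho> p \<Omega> (u' (r (q n))))"
      by (rule Liminf_le_Limsup) simp
    also have "\<dots> \<le> ennreal C" using energy_le by (intro Limsup_bounded) simp
    also have "\<dots> < \<infinity>" by simp
    finally show ?thesis
      using v S_seminorm_pow_eq_nonlocal_energy[OF v'(3)] by (simp add: in_S_space_def)
  qed
  ultimately show ?thesis by blast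
qed

end
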